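(* Consider a purely kinetic Chaplygin system $(L=\frac12 g,\mathcal D)$ with symmetry group $G$ and bundle $\pi:Q\to Q/G$. Let $\overline g$ be a $\mathcal D$-preserving modification of $g$ and $F=f\circ\pi$ with $f\in C^\infty(Q/G)$, and suppose that $(\overline g_{ai},F)$ satisfies the condition (for all $c$ and all values of $(v^a)$) $$(A')\quad g_{bd}\left(\delta_a^dX_c(F)-\delta_c^dX_a(F)\right)v^av^b+\theta_kR^k_{ac}v^a=0,\qquad \theta_k=\overline g_{ak}v^a.$$ Then the condition $$(B')\quad \Gamma^{nh}(\theta_i)+\lambda_i+\theta_k\left(R^k_{ia}+\delta^k_iX_a(F)\right)v^a-g_{ab}X_i(F)v^av^b=0\quad\text{for all } i$$ becomes (is equivalent to) $$\Gamma^{nh}(C_i)+\Gamma^{nh}(F)\,C_i=0\quad\text{for all } i,$$ where $C_i:=C_{ai}v^a:=(\overline g_{ai}+G_{ai})v^a$.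
   Context: Setting: $Q$ is an $n$-dimensional manifold with Riemannian metric $g$, $\mathcal D\subset TQ$ is a distribution of rank $m$, $L(v)=\frac12g(v,v)$. The system is a (purely kinetic) Chaplygin system: a Lie group $G$ acts freely and properly on $Q$, $\pi:Q\to Q/G$ is the principal bundle, $g$ and $\mathcal D$ are $G$-invariant, and $\mathcal D$ is the horizontal distribution of a principal connection on $\pi$ (so $TQ=\mathcal D\oplus V\pi$, with $V\pi=\ker T\pi$, and $\dim Q/G=m$). Indices $a,b,c,d=1,\dots,m$; $i,j,k=1,\dots,n-m$. Summation convention is used. Frames: $V_i$ are the infinitesimal generators of a basis of the Lie algebra of $G$; $X_a$ are the horizontal lifts of the coordinate fields $\partial/\partial q^a$ on $Q/G$. Set $G_{ab}=g(X_a,X_b)$ (inverse $G^{ab}$), $G_{ai}=g(X_a,V_i)$, $K^b_i=-G^{ab}G_{ai}$, $X_i=V_i+K^b_iX_b$. Then $\{X_a,X_i\}$ is a local frame with $X_a$ spanning $\mathcal D$ and $X_i$ spanning its $g$-orthogonal complement. Write $[X_\alpha,X_\beta]=R^\gamma_{\alpha\beta}X_\gamma$ in this frame, $g_{ab}=G_{ab}$, $g_{ij}=g(X_i,X_j)$, $\overline g_{ai}=\overline g(X_a,X_i)$; $v^a,v^i$ are the components of tangent vectors in this frame ($\mathcal D$ is $v^i=0$). With $\nabla$ the Levi-Civita connection of $g$, $\nabla_{X_a}X_b=\Gamma^c_{ab}X_c+\Gamma^i_{ab}X_i$. A symmetric $(0,2)$-tensor field $\overline g$ is a $\mathcal D$-preserving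 modification of $g$ if $\overline g|_{\mathcal D\times\mathcal D}=g|_{\mathcal D\times\mathcal D}$. The nonholonomic vector field $\Gamma^{nh}$ is the vector field on the manifold $\mathcal D$ whose integral curves satisfy $\dot q=v^aX_a(q)$, $\dot v^d=-\Gamma^d_{ab}v^av^b$; so $\Gamma^{nh}(\theta_bv^b)=(X_a(\theta_b)-\theta_d\Gamma^d_{ab})v^av^b$ for functions $\theta_b$ on $Q$, and $\Gamma^{nh}(F)=X_a(F)v^a$. The Lagrange multipliers are $\lambda_i=g_{ki}\Gamma^k_{ab}v^av^b$. *)

theory Defs
  imports "HOL-Analysis.Analysis" "HOL-Algebra.Group_Action"
begin

section \<open>Smooth functions on open subsets of Euclidean spaces\<close>

text \<open>Only meant for open \<open>S\<close>; the derivatives are two-sided.\<close>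

primrec diff_class_on ::
    "nat \<Rightarrow> 'a::real_normed_vector set \<Rightarrow> ('a \<Rightarrow> 'b::real_normed_vector) \<Rightarrow> bool" where
  "diff_class_on 0 S f \<longleftrightarrow> continuous_on S f"
| "diff_class_on (Suc r) S f \<longleftrightarrow>
     (\<forall>x\<in>S. f differentiable (at x)) \<and>
     (\<forall>u. diff_class_on r S (\<lambda>x. frechet_derivative f (at x) u))"

definition smooth_on :: "'a::real_normed_vector set \<Rightarrow> ('a \<Rightarrow> 'b::real_normed_vector) \<Rightarrow> bool" where
  "smooth_on S f \<longleftrightarrow> (\<forall>r. diff_class_on r S f)"


section \<open>Smooth manifolds\<close>

text \<open>A chart \<open>(U, \<phi>)\<close> is given by a coordinate map \<open>\<phi>\<close> that is relevant on its domain \<open>U\<close> only.\<close>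

record ('p, 'e) manifold =
  mtop :: "'p topology"
  atlas :: "('p set \<times> ('p \<Rightarrow> 'e)) set"

abbreviation pts :: "('p, 'e) manifold \<Rightarrow> 'p set" where
  "pts M \<equiv> topspace (mtop M)"

definition smooth_manifold :: "('p, 'e::euclidean_space) manifold \<Rightarrow> bool" where
  "smooth_manifold M \<longleftrightarrow>
     Hausdorff_space (mtop M) \<and> second_countable (mtop M) \<and>
     (\<Union>(U, \<phi>)\<in>atlas M. U) = pts M \<and>
     (\<forall>(U, \<phi>)\<in>atlas M. openin (mtop M) U \<and> open (\<phi> ` U) \<and>
        homeomorphic_map (subtopology (mtop M) U) (top_of_set (\<phi> ` U)) \<phi>) \<and>
     (\<forall>(U, \<phi>)\<in>atlas M. \<forall>(V, \<psi>)\<in>atlas M.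
        smooth_on (\<phi> ` (U \<inter> V)) (\<psi> \<circ> inv_into U \<phi>))"

definition smooth_fun :: "('p, 'e::euclidean_space) manifold \<Rightarrow> 'p set \<Rightarrow> ('p \<Rightarrow> real) \<Rightarrow> bool" where
  "smooth_fun M W f \<longleftrightarrow>
     (\<forall>(U, \<phi>)\<in>atlas M. smooth_on (\<phi> ` (U \<inter> W)) (f \<circ> inv_into U \<phi>))"

definition smooth_near :: "('p, 'e::euclidean_space) manifold \<Rightarrow> 'p \<Rightarrow> ('p \<Rightarrow> real) \<Rightarrow> bool" where
  "smooth_near M p f \<longleftrightarrow> (\<exists>W. openin (mtop M) W \<and> p \<in> W \<and> smooth_fun M W f)"

definition smooth_map ::
    "('p, 'e::euclidean_space) manifold \<Rightarrow> 'p set \<Rightarrow> ('q, 'd::euclidean_space) manifold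
     \<Rightarrow> ('p \<Rightarrow> 'q) \<Rightarrow> bool" where
  "smooth_map M W N F \<longleftrightarrow>
     continuous_map (subtopology (mtop M) W) (mtop N) F \<and>
     (\<forall>(U, \<phi>)\<in>atlas M. \<forall>(V, \<psi>)\<in>atlas N.
        smooth_on (\<phi> ` (U \<inter> W \<inter> F -` V)) (\<psi> \<circ> F \<circ> inv_into U \<phi>))"

definition diffeo_on ::
    "('p, 'e::euclidean_space) manifold \<Rightarrow> 'p set \<Rightarrow> ('q, 'd::euclidean_space) manifold \<Rightarrow> 'q set
     \<Rightarrow> ('p \<Rightarrow> 'q) \<Rightarrow> bool" where
  "diffeo_on M W N W' F \<longleftrightarrow>
     bij_betw F W W' \<and> smooth_map M W N F \<and> smooth_map N W' M (inv_into W F)"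

definition prod_manifold ::
    "('p, 'e::euclidean_space) manifold \<Rightarrow> ('q, 'd::euclidean_space) manifold
     \<Rightarrow> ('p \<times> 'q, 'e \<times> 'd) manifold" where
  "prod_manifold M N =
     \<lparr>mtop = prod_topology (mtop M) (mtop N),
      atlas = {(U \<times> V, map_prod \<phi> \<psi>) | U \<phi> V \<psi>. (U, \<phi>) \<in> atlas M \<and> (V, \<psi>) \<in> atlas N}\<rparr>"


section \<open>Tangent vectors and vector fields\<close>

text \<open>A tangent vector at \<open>p\<close> is the directional derivative operator that it induces on the
  functions that are smooth near \<open>p\<close>. Operators take the value 0 on all other functions, so that
  equality of tangent vectors is equality of operators. The value on a function smooth
  near \<open>p\<close> depends on its germ at \<open>p\<close> only.\<close>

type_synonym 'p tvec = "('p \<Rightarrow> real) \<Rightarrow> real"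
type_synonym 'p vfield = "'p \<Rightarrow> 'p tvec"

definition coord_vec ::
    "('p, 'e::euclidean_space) manifold \<Rightarrow> 'p set \<times> ('p \<Rightarrow> 'e) \<Rightarrow> 'p \<Rightarrow> 'e \<Rightarrow> 'p tvec" where
  "coord_vec M = (\<lambda>(U, \<phi>) p u f.
     if smooth_near M p f then frechet_derivative (f \<circ> inv_into U \<phi>) (at (\<phi> p)) u else 0)"

definition tangent_space :: "('p, 'e::euclidean_space) manifold \<Rightarrow> 'p \<Rightarrow> 'p tvec set" where
  "tangent_space M p = {coord_vec M c p u | c u. c \<in> atlas M \<and> p \<in> fst c}"

definition lincomb :: "'i set \<Rightarrow> ('i \<Rightarrow> real) \<Rightarrow> ('i \<Rightarrow> 'p tvec) \<Rightarrow> 'p tvec" where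
  "lincomb I c Y = (\<lambda>f. \<Sum>j\<in>I. c j * Y j f)"

text \<open>The tangent map at \<open>p\<close> of a map \<open>F\<close> into the manifold \<open>N\<close>.\<close>

definition tangent_map ::
    "('q, 'd::euclidean_space) manifold \<Rightarrow> ('p \<Rightarrow> 'q) \<Rightarrow> 'p \<Rightarrow> 'p tvec \<Rightarrow> 'q tvec" where
  "tangent_map N F p v = (\<lambda>f. if smooth_near N (F p) f then v (f \<circ> F) else 0)"

definition vector_field :: "('p, 'e::euclidean_space) manifold \<Rightarrow> 'p set \<Rightarrow> 'p vfield \<Rightarrow> bool" where
  "vector_field M W X \<longleftrightarrow>
     (\<forall>p\<in>W. X p \<in> tangent_space M p) \<and>
     (\<forall>W' f. openin (mtop M) W' \<and> W' \<subseteq> W \<and> smooth_fun M W' f \<longrightarrow> smooth_fun M W' (\<lambda>p. X p f))"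

definition lie_bracket ::
    "('p, 'e::euclidean_space) manifold \<Rightarrow> 'p vfield \<Rightarrow> 'p vfield \<Rightarrow> 'p vfield" where
  "lie_bracket M X Y = (\<lambda>p f.
     if smooth_near M p f then X p (\<lambda>r. Y r f) - Y p (\<lambda>r. X r f) else 0)"


section \<open>Metrics, connections and distributions\<close>

type_synonym 'p tensor2 = "'p \<Rightarrow> 'p tvec \<Rightarrow> 'p tvec \<Rightarrow> real"

definition symmetric_tensor :: "('p, 'e::euclidean_space) manifold \<Rightarrow> 'p tensor2 \<Rightarrow> bool" where
  "symmetric_tensor M g \<longleftrightarrow>
     (\<forall>p\<in>pts M. \<forall>u\<in>tangent_space M p. \<forall>v\<in>tangent_space M p. g p u v = g p v u) \<and>
     (\<forall>p\<in>pts M. \<forall>u\<in>tangent_space M p. \<forall>v\<in>tangent_space M p. \<forall>w\<in>tangent_space M p. \<forall>a b.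
        g p (\<lambda>f. a * u f + b * v f) w = a * g p u w + b * g p v w) \<and>
     (\<forall>W X Y. openin (mtop M) W \<and> vector_field M W X \<and> vector_field M W Y \<longrightarrow>
        smooth_fun M W (\<lambda>p. g p (X p) (Y p)))"

definition riemannian_metric :: "('p, 'e::euclidean_space) manifold \<Rightarrow> 'p tensor2 \<Rightarrow> bool" where
  "riemannian_metric M g \<longleftrightarrow>
     symmetric_tensor M g \<and>
     (\<forall>p\<in>pts M. \<forall>v\<in>tangent_space M p. v \<noteq> (\<lambda>f. 0) \<longrightarrow> 0 < g p v v)"

definition vector_field_near ::
    "('p, 'e::euclidean_space) manifold \<Rightarrow> 'p \<Rightarrow> 'p vfield \<Rightarrow> bool" where
  "vector_field_near M p X \<longleftrightarrow> (\<exists>W. openin (mtop M) W \<and> p \<in> W \<and> vector_field M W X)"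

text \<open>\<open>nabla p v Y\<close> is the covariant derivative at \<open>p\<close> in the direction \<open>v\<close> of a vector field \<open>Y\<close>
  defined and smooth near \<open>p\<close>, so that local frames can be differentiated directly. The Leibniz
  rule makes it depend on the germ of \<open>Y\<close> at \<open>p\<close> only.\<close>

definition affine_connection ::
    "('p, 'e::euclidean_space) manifold \<Rightarrow> ('p \<Rightarrow> 'p tvec \<Rightarrow> 'p vfield \<Rightarrow> 'p tvec) \<Rightarrow> bool" where
  "affine_connection M nabla \<longleftrightarrow>
     (\<forall>p\<in>pts M. \<forall>v\<in>tangent_space M p. \<forall>Y. vector_field_near M p Y \<longrightarrow>
        nabla p v Y \<in> tangent_space M p) \<and>
     (\<forall>p\<in>pts M. \<forall>u\<in>tangent_space M p. \<forall>v\<in>tangent_space M p. \<forall>a b Y. vector_field_near M p Y \<longrightarrow>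
        nabla p (\<lambda>f. a * u f + b * v f) Y = (\<lambda>f. a * nabla p u Y f + b * nabla p v Y f)) \<and>
     (\<forall>p\<in>pts M. \<forall>v\<in>tangent_space M p. \<forall>Y Z. vector_field_near M p Y \<and> vector_field_near M p Z \<longrightarrow>
        nabla p v (\<lambda>r f. Y r f + Z r f) = (\<lambda>f. nabla p v Y f + nabla p v Z f)) \<and>
     (\<forall>p\<in>pts M. \<forall>v\<in>tangent_space M p. \<forall>h Y. smooth_near M p h \<and> vector_field_near M p Y \<longrightarrow>
        nabla p v (\<lambda>r f. h r * Y r f) = (\<lambda>f. v h * Y p f + h p * nabla p v Y f)) \<and>
     (\<forall>W X Y. openin (mtop M) W \<and> vector_field M W X \<and> vector_field M W Y \<longrightarrow>
        vector_field M W (\<lambda>p. nabla p (X p) Y))"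

definition levi_civita_connection ::
    "('p, 'e::euclidean_space) manifold \<Rightarrow> 'p tensor2
     \<Rightarrow> ('p \<Rightarrow> 'p tvec \<Rightarrow> 'p vfield \<Rightarrow> 'p tvec) \<Rightarrow> bool" where
  "levi_civita_connection M g nabla \<longleftrightarrow>
     affine_connection M nabla \<and>
     (\<forall>p\<in>pts M. \<forall>X Y. vector_field_near M p X \<and> vector_field_near M p Y \<longrightarrow>
        (\<lambda>f. nabla p (X p) Y f - nabla p (Y p) X f) = lie_bracket M X Y p) \<and>
     (\<forall>p\<in>pts M. \<forall>v\<in>tangent_space M p. \<forall>X Y. vector_field_near M p X \<and> vector_field_near M p Y \<longrightarrow>
        v (\<lambda>r. g r (X r) (Y r)) = g p (nabla p v X) (Y p) + g p (X p) (nabla p v Y))"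

definition distribution ::
    "('p, 'e::euclidean_space) manifold \<Rightarrow> nat \<Rightarrow> ('p \<Rightarrow> 'p tvec set) \<Rightarrow> bool" where
  "distribution M r D \<longleftrightarrow>
     (\<forall>p\<in>pts M. \<exists>W. openin (mtop M) W \<and> p \<in> W \<and>
       (\<exists>Y. (\<forall>j<r. vector_field M W (Y j)) \<and>
         (\<forall>x\<in>W. D x = {lincomb {..<r} c (\<lambda>j. Y j x) | c. True} \<and>
            (\<forall>c. lincomb {..<r} c (\<lambda>j. Y j x) = (\<lambda>f. 0) \<longrightarrow> (\<forall>j<r. c j = 0)))))"

definition preserving_modification ::
    "('p, 'e::euclidean_space) manifold \<Rightarrow> ('p \<Rightarrow> 'p tvec set) \<Rightarrow> 'p tensor2 \<Rightarrow> 'p tensor2 \<Rightarrow> bool" where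
  "preserving_modification M D g gbar \<longleftrightarrow>
     symmetric_tensor M gbar \<and> (\<forall>p\<in>pts M. \<forall>u\<in>D p. \<forall>v\<in>D p. gbar p u v = g p u v)"


section \<open>Lie group actions and principal bundles\<close>

definition lie_group :: "'g monoid \<Rightarrow> ('g, 'h::euclidean_space) manifold \<Rightarrow> bool" where
  "lie_group G GM \<longleftrightarrow>
     group G \<and> smooth_manifold GM \<and> pts GM = carrier G \<and>
     smooth_map (prod_manifold GM GM) (carrier G \<times> carrier G) GM (\<lambda>(x, y). x \<otimes>\<^bsub>G\<^esub> y) \<and>
     smooth_map GM (carrier G) GM (\<lambda>x. inv\<^bsub>G\<^esub> x)"

definition free_proper_action ::
    "'g monoid \<Rightarrow> ('g, 'h::euclidean_space) manifold \<Rightarrow> ('q, 'e::euclidean_space) manifold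
     \<Rightarrow> ('g \<Rightarrow> 'q \<Rightarrow> 'q) \<Rightarrow> bool" where
  "free_proper_action G GM Q act \<longleftrightarrow>
     group_action G (pts Q) act \<and>
     smooth_map (prod_manifold GM Q) (carrier G \<times> pts Q) Q (\<lambda>(h, q). act h q) \<and>
     (\<forall>q\<in>pts Q. stabilizer G act q = {\<one>\<^bsub>G\<^esub>}) \<and>
     proper_map (prod_topology (mtop GM) (mtop Q)) (prod_topology (mtop Q) (mtop Q))
       (\<lambda>(h, q). (act h q, q))"

text \<open>\<open>B\<close> is \<open>Q/G\<close>: its points are the orbits, its topology and smooth structure are determined by
  local triviality, and the projection \<open>Q \<rightarrow> Q/G\<close> is \<open>orbit G act\<close>.\<close>

definition principal_bundle ::
    "'g monoid \<Rightarrow> ('g, 'h::euclidean_space) manifold \<Rightarrow> ('q, 'e::euclidean_space) manifold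
     \<Rightarrow> ('g \<Rightarrow> 'q \<Rightarrow> 'q) \<Rightarrow> ('q set, 'b::euclidean_space) manifold \<Rightarrow> bool" where
  "principal_bundle G GM Q act B \<longleftrightarrow>
     smooth_manifold B \<and> pts B = orbits G (pts Q) act \<and>
     smooth_map Q (pts Q) B (orbit G act) \<and>
     (\<forall>b\<in>pts B. \<exists>U s. openin (mtop B) U \<and> b \<in> U \<and>
        diffeo_on Q {q \<in> pts Q. orbit G act q \<in> U} (prod_manifold B GM) (U \<times> carrier G)
          (\<lambda>q. (orbit G act q, s q)) \<and>
        (\<forall>h\<in>carrier G. \<forall>q\<in>pts Q. orbit G act q \<in> U \<longrightarrow> s (act h q) = h \<otimes>\<^bsub>G\<^esub> s q))"

text \<open>The Lie algebra is identified with the tangent space at the identity; the value at \<open>q\<close> of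
  the infinitesimal generator of \<open>\<xi>\<close> is the image of \<open>\<xi>\<close> under the tangent map of
  \<open>h \<mapsto> h \<cdot> q\<close>, that is, the derivative of \<open>exp (t \<xi>) \<cdot> q\<close> at \<open>t = 0\<close>.\<close>

definition infinitesimal_generator ::
    "'g monoid \<Rightarrow> ('q, 'e::euclidean_space) manifold \<Rightarrow> ('g \<Rightarrow> 'q \<Rightarrow> 'q) \<Rightarrow> 'g tvec \<Rightarrow> 'q vfield" where
  "infinitesimal_generator G Q act \<xi> = (\<lambda>q. tangent_map Q (\<lambda>h. act h q) \<one>\<^bsub>G\<^esub> \<xi>)"

definition lie_algebra_basis ::
    "'g monoid \<Rightarrow> ('g, 'h::euclidean_space) manifold \<Rightarrow> ('k::finite \<Rightarrow> 'g tvec) \<Rightarrow> bool" where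
  "lie_algebra_basis G GM \<xi> \<longleftrightarrow>
     (\<forall>i. \<xi> i \<in> tangent_space GM \<one>\<^bsub>G\<^esub>) \<and>
     (\<forall>v\<in>tangent_space GM \<one>\<^bsub>G\<^esub>. \<exists>!c. v = lincomb UNIV c \<xi>)"

definition vertical_space ::
    "('q, 'e::euclidean_space) manifold \<Rightarrow> ('b, 'd::euclidean_space) manifold
     \<Rightarrow> ('q \<Rightarrow> 'b) \<Rightarrow> 'q \<Rightarrow> 'q tvec set" where
  "vertical_space Q B \<pi> q = {v \<in> tangent_space Q q. tangent_map B \<pi> q v = (\<lambda>f. 0)}"

definition principal_connection ::
    "'g monoid \<Rightarrow> ('q, 'e::euclidean_space) manifold \<Rightarrow> ('g \<Rightarrow> 'q \<Rightarrow> 'q)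
     \<Rightarrow> ('q set, 'b::euclidean_space) manifold \<Rightarrow> ('q \<Rightarrow> 'q tvec set) \<Rightarrow> bool" where
  "principal_connection G Q act B D \<longleftrightarrow>
     distribution Q DIM('b) D \<and>
     (\<forall>h\<in>carrier G. \<forall>q\<in>pts Q. tangent_map Q (act h) q ` D q = D (act h q)) \<and>
     (\<forall>q\<in>pts Q. D q \<subseteq> tangent_space Q q \<and>
        (\<forall>v\<in>tangent_space Q q.
           \<exists>!z. z \<in> D q \<times> vertical_space Q B (orbit G act) q \<and> v = (\<lambda>f. fst z f + snd z f)))"

definition horizontal_lift ::
    "('q, 'e::euclidean_space) manifold \<Rightarrow> ('q \<Rightarrow> 'q tvec set) \<Rightarrow> ('b, 'd::euclidean_space) manifold
     \<Rightarrow> ('q \<Rightarrow> 'b) \<Rightarrow> 'q set \<Rightarrow> 'b vfield \<Rightarrow> 'q vfield \<Rightarrow> bool" where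
  "horizontal_lift Q D B \<pi> W Z X \<longleftrightarrow>
     vector_field Q W X \<and> (\<forall>q\<in>W. X q \<in> D q \<and> tangent_map B \<pi> q (X q) = Z (\<pi> q))"


section \<open>Chaplygin systems and the nonholonomic vector field\<close>

definition chaplygin_system ::
    "'g monoid \<Rightarrow> ('g, 'h::euclidean_space) manifold \<Rightarrow> ('q, 'e::euclidean_space) manifold
     \<Rightarrow> ('g \<Rightarrow> 'q \<Rightarrow> 'q) \<Rightarrow> ('q set, 'b::euclidean_space) manifold \<Rightarrow> 'q tensor2
     \<Rightarrow> ('q \<Rightarrow> 'q tvec set) \<Rightarrow> bool" where
  "chaplygin_system G GM Q act B g D \<longleftrightarrow>
     smooth_manifold Q \<and> lie_group G GM \<and>
     free_proper_action G GM Q act \<and> principal_bundle G GM Q act B \<and>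
     riemannian_metric Q g \<and>
     (\<forall>h\<in>carrier G. \<forall>q\<in>pts Q. \<forall>u\<in>tangent_space Q q. \<forall>v\<in>tangent_space Q q.
        g (act h q) (tangent_map Q (act h) q u) (tangent_map Q (act h) q v) = g q u v) \<and>
     principal_connection G Q act B D"

text \<open>The part of the manifold \<open>\<D>\<close> over the domain \<open>W\<close> of a frame \<open>X\<close> of \<open>\<D>\<close> is \<open>W \<times> \<real>\<^sup>m\<close>
  by means of the components \<open>v\<close>, and functions on it are written as \<open>\<Phi> q v\<close>. The vector field
  is \<open>v\<^sup>a X\<^sub>a - \<Gamma>\<^sup>d\<^sub>a\<^sub>b v\<^sup>a v\<^sup>b \<partial>/\<partial>v\<^sup>d\<close>,
  where \<open>X\<^sub>a\<close> acts with \<open>v\<close> held fixed, and \<open>\<Gamma> d a b\<close> stands for \<open>\<Gamma>\<^sup>d\<^sub>a\<^sub>b\<close>.\<close>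

definition nonholonomic_field ::
    "('m::finite \<Rightarrow> 'q vfield) \<Rightarrow> ('m \<Rightarrow> 'm \<Rightarrow> 'm \<Rightarrow> 'q \<Rightarrow> real)
     \<Rightarrow> ('q \<Rightarrow> real^'m \<Rightarrow> real) \<Rightarrow> 'q \<Rightarrow> real^'m \<Rightarrow> real" where
  "nonholonomic_field X \<Gamma> \<Phi> q v =
     (\<Sum>a\<in>UNIV. v $ a * X a q (\<lambda>r. \<Phi> r v)) +
     frechet_derivative (\<Phi> q) (at v) (\<chi> d. - (\<Sum>a\<in>UNIV. \<Sum>b\<in>UNIV. \<Gamma> d a b q * v $ a * v $ b))"

end

theory Submission
  imports Defs
begin

text \<open>
  Both sides agree pointwise. The bundle enters through \<open>V\<^sub>i(F) = 0\<close>, \<open>V\<^sub>i(G\<^sub>a\<^sub>b) = 0\<close> and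
  \<open>[V\<^sub>i, X\<^sub>a] = 0\<close>; the last one holds because horizontal lifts are invariant and mixed
  partial derivatives of \<open>(h, q) \<mapsto> f (h \<cdot> q)\<close> commute. Hence \<open>X\<^sub>i(F)\<close> equals
  \<open>K\<^sup>b\<^sub>i X\<^sub>b(F)\<close>, and \<open>[X\<^sub>i, X\<^sub>a]\<close> equals \<open>K\<^sup>b\<^sub>i [X\<^sub>b, X\<^sub>a]\<close> modulo the
  distribution. Contracting (A') with \<open>K\<^sup>c\<^sub>i\<close> therefore turns the curvature and \<open>X\<^sub>i(F)\<close> terms of
  (B') into \<open>\<Gamma>\<^sup>n\<^sup>h(F) G\<^sub>a\<^sub>i v\<^sup>a\<close>. Along the distribution \<open>V\<^sub>i\<close> satisfies Killing's equation, so
  \<open>\<lambda>\<^sub>i = \<Gamma>\<^sup>n\<^sup>h(G\<^sub>a\<^sub>i v\<^sup>a)\<close> is the derivative of the momentum along the flow.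
\<close>

section \<open>Calculus of smooth functions on open sets\<close>

text \<open>Most of the work goes into the commutation of generators with horizontal lifts. A
  generator is a tangent map of \<open>h \<mapsto> act h q\<close>, with no flow at hand, so both
  orders of differentiation have to be read off one function of group and configuration variables
  together. That requires joint smoothness of the action in product charts, smoothness of its
  slices, and symmetry of second derivatives for functions whose class is defined by directional
  derivatives. A second obstacle is that \<open>R\<close> and \<open>\<Gamma>\<close> are known only
  through expansions in the frame. Identities for them are therefore obtained from vectors: a vector
  that lies in the distribution and in its orthogonal complement vanishes, and pairing it with a
  tensor gives the scalar identity. The transversal coefficients occur only contracted with
  \<open>gij\<close> or \<open>gbarai\<close>, which is exactly what such pairings produce. The
  orthogonal frame itself has to be smooth before brackets can be expanded; its coefficients
  \<open>K\<close> contain an inverse Gram matrix, which is handled by determinants.\<close>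

lemma diff_class_on_cong:
  assumes "open S" "\<And>x. x \<in> S \<Longrightarrow> f x = g x" "diff_class_on r S f"
  shows "diff_class_on r S g"
  using assms
proof (induction r arbitrary: f g)
  case 0
  then show ?case by (metis continuous_on_cong diff_class_on.simps(1))
next
  case (Suc r)
  have "(g has_derivative frechet_derivative f (at x)) (at x)" if "x \<in> S" for x
    using Suc.prems that
    by (auto intro!: has_derivative_transform_within_open[of f _ x UNIV S g]
        simp: frechet_derivative_works)
  then have d: "g differentiable at x" "frechet_derivative g (at x) = frechet_derivative f (at x)"
    if "x \<in> S" for x
    using that frechet_derivative_at differentiableI by metis+
  have "diff_class_on r S (\<lambda>x. frechet_derivative g (at x) u)" for u
    by (rule Suc.IH[of "\<lambda>x. frechet_derivative f (at x) u"]) (use Suc.prems d in auto)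
  with d show ?case by simp
qed

text \<open>Allows the derivative to be given by a formula \<open>D\<close>. On an open set it can
  replace \<open>frechet_derivative\<close> at every point, so its class can be examined
  instead.\<close>

lemma diff_class_on_SucI:
  assumes "open S" "\<And>x. x \<in> S \<Longrightarrow> (f has_derivative D x) (at x)"
    and "\<And>u. diff_class_on r S (\<lambda>x. D x u)"
  shows "diff_class_on (Suc r) S f"
proof -
  have d: "f differentiable at x" "frechet_derivative f (at x) = D x" if "x \<in> S" for x
    using assms(2)[OF that] frechet_derivative_at differentiableI by metis+
  have "diff_class_on r S (\<lambda>x. frechet_derivative f (at x) u)" for u
    by (rule diff_class_on_cong[OF assms(1) _ assms(3)[of u]]) (simp add: d)
  with d show ?thesis by simp
qed

lemma diff_class_on_SucD:
  assumes "diff_class_on (Suc r) S f"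
  shows "diff_class_on r S f"
  using assms
proof (induction r arbitrary: f)
  case 0
  then show ?case
    by (auto intro!: continuous_at_imp_continuous_on differentiable_imp_continuous_within)
qed simp

lemma diff_class_on_has_derivative:
  assumes "diff_class_on (Suc r) S f" "x \<in> S"
  shows "(f has_derivative frechet_derivative f (at x)) (at x)"
  using assms by (simp add: frechet_derivative_works)

lemma diff_class_on_subset:
  assumes "diff_class_on r S f" "T \<subseteq> S"
  shows "diff_class_on r T f"
  using assms by (induction r arbitrary: f) (auto intro: continuous_on_subset)

text \<open>Differentiability and its iterates only see neighbourhoods. Needed where a chart of the
  target can be chosen only after the point.\<close>

lemma diff_class_on_local:
  assumes "\<And>x. x \<in> S \<Longrightarrow> \<exists>T. open T \<and> x \<in> T \<and> diff_class_on r T f"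
  shows "diff_class_on r S f"
  using assms
proof (induction r arbitrary: f)
  case 0
  then have "\<exists>T. open T \<and> x \<in> T \<and> continuous_on T f" if "x \<in> S" for x
    using that by simp
  then have "isCont f x" if "x \<in> S" for x
    using that continuous_on_eq_continuous_at by blast
  then show ?case by (simp add: continuous_at_imp_continuous_on)
next
  case (Suc r)
  show ?case
    unfolding diff_class_on.simps
  proof (intro conjI ballI allI)
    fix x assume "x \<in> S"
    then show "f differentiable at x" using Suc.prems by fastforce
  next
    fix u
    show "diff_class_on r S (\<lambda>x. frechet_derivative f (at x) u)"
      using Suc.prems by (intro Suc.IH) fastforce
  qed
qed

lemma diff_class_on_const: "diff_class_on r S (\<lambda>x. c)"
  by (induction r arbitrary: c) auto

lemma diff_class_on_add:
  assumes "open S" "diff_class_on r S f" "diff_class_on r S g"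
  shows "diff_class_on r S (\<lambda>x. f x + g x)"
  using assms
proof (induction r arbitrary: f g)
  case (Suc r)
  show ?case
  proof (rule diff_class_on_SucI[where
        D = "\<lambda>x u. frechet_derivative f (at x) u + frechet_derivative g (at x) u"])
    show "diff_class_on r S (\<lambda>x. frechet_derivative f (at x) u + frechet_derivative g (at x) u)" for u
      by (rule Suc.IH) (use Suc.prems in auto)
  qed (use Suc.prems in \<open>auto intro!: has_derivative_add simp: frechet_derivative_works\<close>)
qed (simp add: continuous_on_add)

lemma diff_class_on_sum:
  assumes "open S" "\<And>i. i \<in> I \<Longrightarrow> diff_class_on r S (f i)"
  shows "diff_class_on r S (\<lambda>x. \<Sum>i\<in>I. f i x)"
  using assms(2)
  by (induction I rule: infinite_finite_induct)
    (auto intro: diff_class_on_const diff_class_on_add[OF assms(1)])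

lemma diff_class_on_linear:
  assumes "open S" "bounded_linear L" "diff_class_on r S f"
  shows "diff_class_on r S (\<lambda>x. L (f x))"
  using assms
proof (induction r arbitrary: f)
  case 0
  then show ?case by (simp add: bounded_linear.continuous_on)
next
  case (Suc r)
  show ?case
  proof (rule diff_class_on_SucI[where D = "\<lambda>x u. L (frechet_derivative f (at x) u)"])
    show "diff_class_on r S (\<lambda>x. L (frechet_derivative f (at x) u))" for u
      by (rule Suc.IH) (use Suc.prems in auto)
    show "((\<lambda>x. L (f x)) has_derivative (\<lambda>u. L (frechet_derivative f (at x) u))) (at x)"
      if "x \<in> S" for x
      by (rule bounded_linear.has_derivative[OF Suc.prems(2)
            diff_class_on_has_derivative[OF Suc.prems(3) that]])
  qed (rule Suc.prems)
qed

text \<open>Each term of the product rule is again \<open>P\<close> applied to one function and one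
  derivative, both of class \<open>r\<close>, so the induction runs over both functions at
  once.\<close>

lemma diff_class_on_bilinear:
  assumes "open S" "bounded_bilinear P" "diff_class_on r S f" "diff_class_on r S g"
  shows "diff_class_on r S (\<lambda>x. P (f x) (g x))"
  using assms
proof (induction r arbitrary: f g)
  case 0
  then show ?case by (simp add: bounded_bilinear.continuous_on)
next
  case (Suc r)
  have "diff_class_on r S f" "diff_class_on r S g"
    using Suc.prems diff_class_on_SucD by blast+
  show ?case
  proof (rule diff_class_on_SucI[where D = "\<lambda>x u. P (f x) (frechet_derivative g (at x) u)
          + P (frechet_derivative f (at x) u) (g x)"])
    show "diff_class_on r S (\<lambda>x. P (f x) (frechet_derivative g (at x) u)
          + P (frechet_derivative f (at x) u) (g x))" for u
      by (intro diff_class_on_add Suc.IH)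
        (use Suc.prems \<open>diff_class_on r S f\<close> \<open>diff_class_on r S g\<close> in auto)
    show "((\<lambda>x. P (f x) (g x)) has_derivative (\<lambda>u. P (f x) (frechet_derivative g (at x) u)
          + P (frechet_derivative f (at x) u) (g x))) (at x)" if "x \<in> S" for x
      by (rule bounded_bilinear.FDERIV[OF Suc.prems(2)
            diff_class_on_has_derivative[OF Suc.prems(3) that]
            diff_class_on_has_derivative[OF Suc.prems(4) that]])
  qed (rule Suc.prems)
qed

lemma diff_class_on_inverse:
  fixes f :: "'a::real_normed_vector \<Rightarrow> real"
  assumes "open S" "diff_class_on r S f" "\<And>x. x \<in> S \<Longrightarrow> f x \<noteq> 0"
  shows "diff_class_on r S (\<lambda>x. inverse (f x))"
  using assms(2)
proof (induction r)
  case 0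
  then show ?case using assms(3) by (simp add: continuous_on_inverse)
next
  case (Suc r)
  \<comment> \<open>The derivative contains the reciprocal itself, but only its class
    \<open>r\<close> is needed here, and that is the induction hypothesis.\<close>
  let ?D = "\<lambda>x u. - (inverse (f x) * frechet_derivative f (at x) u * inverse (f x))"
  note mult = diff_class_on_bilinear[OF assms(1) bounded_bilinear_mult]
  have inv: "diff_class_on r S (\<lambda>x. inverse (f x))"
    using Suc diff_class_on_SucD by blast
  have "diff_class_on r S (\<lambda>x. ?D x u)" for u
    using Suc.prems inv
    by (intro diff_class_on_linear[OF assms(1) bounded_linear_minus[OF bounded_linear_ident]] mult)
      auto
  then show ?case
    using Suc.prems assms(3)
    by (intro diff_class_on_SucI[OF assms(1), where D = ?D])
      (auto intro!: has_derivative_inverse simp: frechet_derivative_works)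
qed

lemma diff_class_on_compose:
  fixes f :: "'a::real_normed_vector \<Rightarrow> 'b::euclidean_space"
    and g :: "'b \<Rightarrow> 'c::real_normed_vector"
  assumes "open S" "f ` S \<subseteq> T" "diff_class_on r S f" "diff_class_on r T g"
  shows "diff_class_on r S (\<lambda>x. g (f x))"
  using assms
proof (induction r arbitrary: g)
  case 0
  then show ?case by (auto intro: continuous_on_compose2)
next
  case (Suc r)
  let ?D = "\<lambda>x u. frechet_derivative g (at (f x)) (frechet_derivative f (at x) u)"
  have fr: "diff_class_on r S f" using Suc.prems diff_class_on_SucD by blast
  have d: "(f has_derivative frechet_derivative f (at x)) (at x)"
    "(g has_derivative frechet_derivative g (at (f x))) (at (f x))" if "x \<in> S" for x
    using Suc.prems that by (auto simp: frechet_derivative_works)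
  \<comment> \<open>The direction in which \<open>g\<close> is differentiated moves with
    \<open>x\<close>, while the class of \<open>g\<close> controls fixed directions only. Expanding
    the direction in \<open>Basis\<close> leaves fixed directions with scalar coefficients.\<close>
  have "diff_class_on r S (\<lambda>x. ?D x u)" for u
  proof (rule diff_class_on_cong[OF \<open>open S\<close>])
    fix x assume "x \<in> S"
    interpret D: linear "frechet_derivative g (at (f x))"
      using d(2)[OF \<open>x \<in> S\<close>] has_derivative_linear by blast
    have "?D x u = frechet_derivative g (at (f x))
        (\<Sum>b\<in>Basis. (frechet_derivative f (at x) u \<bullet> b) *\<^sub>R b)"
      by (simp add: euclidean_representation)
    then show "(\<Sum>b\<in>Basis. (frechet_derivative f (at x) u \<bullet> b) *\<^sub>R
        frechet_derivative g (at (f x)) b) = ?D x u"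
      by (simp add: D.sum D.scale)
  next
    show "diff_class_on r S (\<lambda>x. \<Sum>b\<in>Basis. (frechet_derivative f (at x) u \<bullet> b) *\<^sub>R
        frechet_derivative g (at (f x)) b)"
      using Suc.prems fr
      by (intro diff_class_on_sum diff_class_on_bilinear[OF \<open>open S\<close> bounded_bilinear_scaleR]
          diff_class_on_linear[OF \<open>open S\<close> bounded_linear_inner_left] Suc.IH) auto
  qed
  then show ?case
    using has_derivative_compose[OF d]
    by (intro diff_class_on_SucI[OF \<open>open S\<close>, where D = ?D]) auto
qed

lemma diff_class_on_affine:
  assumes "open S" "bounded_linear L"
  shows "diff_class_on r S (\<lambda>x. c + L x)"
proof (cases r)
  case 0
  then show ?thesis
    using assms by (auto intro!: continuous_intros simp: linear_continuous_on)
next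
  case (Suc s)
  have "((\<lambda>x. c + L x) has_derivative L) (at x)" for x
    using has_derivative_add[OF has_derivative_const bounded_linear_imp_has_derivative[OF assms(2)]]
    by simp
  then show ?thesis
    using assms(1) diff_class_on_const unfolding Suc
    by (intro diff_class_on_SucI[where D = "\<lambda>x. L"])
qed

lemma smooth_on_has_derivative:
  assumes "smooth_on S f" "x \<in> S"
  shows "(f has_derivative frechet_derivative f (at x)) (at x)"
  using assms diff_class_on_has_derivative unfolding smooth_on_def by blast

lemma smooth_on_frechet_derivative:
  assumes "smooth_on S f"
  shows "smooth_on S (\<lambda>x. frechet_derivative f (at x) u)"
  unfolding smooth_on_def
proof
  fix r
  have "diff_class_on (Suc r) S f" using assms by (simp add: smooth_on_def)
  then show "diff_class_on r S (\<lambda>x. frechet_derivative f (at x) u)" by simp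
qed

lemma smooth_on_cong:
  assumes "open S" "\<And>x. x \<in> S \<Longrightarrow> f x = g x" "smooth_on S f"
  shows "smooth_on S g"
  using diff_class_on_cong[OF assms(1,2)] assms(3) by (simp add: smooth_on_def)

lemma smooth_on_subset: "smooth_on S f \<Longrightarrow> T \<subseteq> S \<Longrightarrow> smooth_on T f"
  by (auto simp: smooth_on_def intro: diff_class_on_subset)

lemma smooth_on_local:
  assumes "\<And>x. x \<in> S \<Longrightarrow> \<exists>T. open T \<and> x \<in> T \<and> smooth_on T f"
  shows "smooth_on S f"
  unfolding smooth_on_def
proof
  fix r
  show "diff_class_on r S f"
  proof (rule diff_class_on_local)
    fix x assume "x \<in> S"
    then show "\<exists>T. open T \<and> x \<in> T \<and> diff_class_on r T f"
      using assms[of x] by (auto simp: smooth_on_def)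
  qed
qed

lemma smooth_on_const: "smooth_on S (\<lambda>x. c)"
  by (simp add: smooth_on_def diff_class_on_const)

lemma smooth_on_add:
  "open S \<Longrightarrow> smooth_on S f \<Longrightarrow> smooth_on S g \<Longrightarrow> smooth_on S (\<lambda>x. f x + g x)"
  by (simp add: smooth_on_def diff_class_on_add)

lemma smooth_on_mult:
  fixes f g :: "'a::real_normed_vector \<Rightarrow> real"
  shows "open S \<Longrightarrow> smooth_on S f \<Longrightarrow> smooth_on S g \<Longrightarrow> smooth_on S (\<lambda>x. f x * g x)"
  by (simp add: smooth_on_def diff_class_on_bilinear bounded_bilinear_mult)

lemma smooth_on_inverse:
  fixes f :: "'a::real_normed_vector \<Rightarrow> real"
  shows "open S \<Longrightarrow> smooth_on S f \<Longrightarrow> (\<And>x. x \<in> S \<Longrightarrow> f x \<noteq> 0) \<Longrightarrow> smooth_on S (\<lambda>x. inverse (f x))"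
  by (simp add: smooth_on_def diff_class_on_inverse)

lemma smooth_on_compose:
  fixes f :: "'a::real_normed_vector \<Rightarrow> 'b::euclidean_space"
    and g :: "'b \<Rightarrow> 'c::real_normed_vector"
  assumes "open S" "f ` S \<subseteq> T" "smooth_on S f" "smooth_on T g"
  shows "smooth_on S (\<lambda>x. g (f x))"
  unfolding smooth_on_def
proof
  fix r
  show "diff_class_on r S (\<lambda>x. g (f x))"
    by (rule diff_class_on_compose[OF assms(1,2)]) (use assms(3,4) in \<open>auto simp: smooth_on_def\<close>)
qed

lemma smooth_on_affine:
  "open S \<Longrightarrow> bounded_linear L \<Longrightarrow> smooth_on S (\<lambda>x. c + L x)"
  by (simp add: smooth_on_def diff_class_on_affine)

text \<open>Both mixed derivatives are limits of the second difference quotient.\<close>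

lemma second_difference_mvt:
  fixes f :: "'a::real_normed_vector \<Rightarrow> real"
  assumes ball: "ball p e \<subseteq> S" and f: "diff_class_on 2 S f"
    and h: "0 < h" "h * (norm u + norm w) < e"
  shows "\<exists>z. dist p z \<le> h * (norm u + norm w) \<and>
    f (p + h *\<^sub>R u + h *\<^sub>R w) - f (p + h *\<^sub>R u) - f (p + h *\<^sub>R w) + f p
      = h * h * frechet_derivative (\<lambda>y. frechet_derivative f (at y) u) (at z) w"
proof -
  have two: "(2::nat) = Suc (Suc 0)" by simp
  let ?P = "\<lambda>s t. p + s *\<^sub>R u + t *\<^sub>R w"
  let ?D = "\<lambda>y. frechet_derivative f (at y) u"
  have near: "dist p (?P s t) \<le> h * (norm u + norm w)" if "0 \<le> s" "s \<le> h" "0 \<le> t" "t \<le> h" for s t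
  proof -
    have "dist p (?P s t) = norm (s *\<^sub>R u + t *\<^sub>R w)"
      by (simp add: dist_norm norm_minus_commute algebra_simps)
    also have "\<dots> \<le> s * norm u + t * norm w"
      using that norm_triangle_ineq[of "s *\<^sub>R u" "t *\<^sub>R w"] by simp
    also have "\<dots> \<le> h * norm u + h * norm w"
      using that by (intro add_mono mult_right_mono) auto
    finally show ?thesis by (simp add: algebra_simps)
  qed
  then have inS: "?P s t \<in> S" if "0 \<le> s" "s \<le> h" "0 \<le> t" "t \<le> h" for s t
    using that h(2) ball by (meson mem_ball order_le_less_trans subsetD)
  have df: "(f has_derivative frechet_derivative f (at x)) (at x)"
    "(?D has_derivative frechet_derivative ?D (at x)) (at x)" if "x \<in> S" for x
    using f that unfolding two by (auto simp: frechet_derivative_works)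
  \<comment> \<open>The mean value theorem is applied first in \<open>s\<close> to the increment of
    \<open>f\<close> along \<open>w\<close>, then in \<open>t\<close> to the derivative
    \<open>?D\<close> found there.\<close>
  have ds: "((\<lambda>s. f (?P s h) - f (?P s 0)) has_real_derivative (?D (?P s h) - ?D (?P s 0))) (at s)"
    if "0 \<le> s" "s \<le> h" for s
  proof -
    have l: "((\<lambda>s. ?P s t) has_derivative (\<lambda>x. x *\<^sub>R u)) (at s)" for t
      by (auto intro!: derivative_eq_intros)
    have "((\<lambda>s. f (?P s t)) has_derivative (\<lambda>x. frechet_derivative f (at (?P s t)) (x *\<^sub>R u))) (at s)"
      if "0 \<le> t" "t \<le> h" for t
      by (rule has_derivative_compose[OF l df(1)[OF inS]]) (use that \<open>0 \<le> s\<close> \<open>s \<le> h\<close> in auto)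
    then have "((\<lambda>s. f (?P s t)) has_real_derivative ?D (?P s t)) (at s)" if t: "0 \<le> t" "t \<le> h" for t
      unfolding has_field_derivative_def
      by (rule has_derivative_eq_rhs[OF _ ext])
        (use t linear_scale[OF has_derivative_linear[OF df(1)[OF inS]]] \<open>0 \<le> s\<close> \<open>s \<le> h\<close> in auto)
    from this[of h] this[of 0] show ?thesis
      using h(1) by (intro DERIV_diff) auto
  qed
  obtain s where s: "0 < s" "s < h"
    "(f (?P h h) - f (?P h 0)) - (f (?P 0 h) - f (?P 0 0)) = (h - 0) * (?D (?P s h) - ?D (?P s 0))"
    using MVT2[OF h(1) ds] by auto
  have dt: "((\<lambda>t. ?D (?P s t)) has_real_derivative frechet_derivative ?D (at (?P s t)) w) (at t)"
    if "0 \<le> t" "t \<le> h" for t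
  proof -
    have l: "((\<lambda>t. ?P s t) has_derivative (\<lambda>x. x *\<^sub>R w)) (at t)"
      by (auto intro!: derivative_eq_intros)
    have i: "?P s t \<in> S" using inS s that by auto
    show ?thesis
      using has_derivative_compose[OF l df(2)[OF i]] linear_scale[OF has_derivative_linear[OF df(2)[OF i]]]
      unfolding has_field_derivative_def
      by (elim has_derivative_eq_rhs) (auto simp: fun_eq_iff)
  qed
  obtain t where t: "0 < t" "t < h"
    "?D (?P s h) - ?D (?P s 0) = (h - 0) * frechet_derivative ?D (at (?P s t)) w"
    using MVT2[OF h(1) dt] by blast
  show ?thesis
    using s t near[of s t] by (intro exI[of _ "?P s t"]) (auto simp: algebra_simps)
qed

text \<open>The second difference is symmetric in \<open>u\<close> and \<open>w\<close>, so the two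
  mixed derivatives take a common value at two points arbitrarily close to \<open>p\<close>;
  continuity at \<open>p\<close> then excludes a gap.\<close>

lemma frechet_derivative_commute:
  fixes f :: "'a::real_normed_vector \<Rightarrow> real"
  assumes "open S" "p \<in> S" "smooth_on S f"
  shows "frechet_derivative (\<lambda>y. frechet_derivative f (at y) u) (at p) w
       = frechet_derivative (\<lambda>y. frechet_derivative f (at y) w) (at p) u"
proof -
  let ?A = "\<lambda>z. frechet_derivative (\<lambda>y. frechet_derivative f (at y) u) (at z) w"
  let ?B = "\<lambda>z. frechet_derivative (\<lambda>y. frechet_derivative f (at y) w) (at z) u"
  have f2: "diff_class_on 2 S f" using assms by (simp add: smooth_on_def)
  have cont: "isCont ?A p" "isCont ?B p"
    using f2 assms(1,2)
    by (auto simp: numeral_2_eq_2 continuous_on_eq_continuous_at)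
  obtain e where e: "0 < e" "ball p e \<subseteq> S"
    using assms(1,2) open_contains_ball by blast
  show ?thesis
  proof (rule ccontr)
    assume neq: "?A p \<noteq> ?B p"
    \<comment> \<open>With half the gap as radius, the open intervals around the two values are
      disjoint.\<close>
    define d where "d = \<bar>?A p - ?B p\<bar> / 2"
    have "0 < d" using neq by (simp add: d_def)
    obtain e1 where e1: "0 < e1" "\<And>z. dist z p < e1 \<Longrightarrow> \<bar>?A z - ?A p\<bar> < d"
      using cont(1) \<open>0 < d\<close> unfolding continuous_at_eps_delta dist_real_def by meson
    obtain e2 where e2: "0 < e2" "\<And>z. dist z p < e2 \<Longrightarrow> \<bar>?B z - ?B p\<bar> < d"
      using cont(2) \<open>0 < d\<close> unfolding continuous_at_eps_delta dist_real_def by meson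
    define m where "m = min e (min e1 e2)"
    \<comment> \<open>The summand 1 keeps the denominator positive for \<open>u = w = 0\<close> and
      makes the bound by \<open>m\<close> strict.\<close>
    define h where "h = m / (norm u + norm w + 1)"
    have m: "0 < m" "m \<le> e" "m \<le> e1" "m \<le> e2" using e e1 e2 by (auto simp: m_def)
    have n: "0 < norm u + norm w + 1" by (simp add: add_nonneg_pos)
    have h: "0 < h" using m n by (simp add: h_def)
    have "h * (norm u + norm w + 1) = m" using n by (simp add: h_def)
    then have hm: "h * (norm u + norm w) < m" using h by (simp add: algebra_simps)
    obtain z where z: "dist p z \<le> h * (norm u + norm w)"
      "f (p + h *\<^sub>R u + h *\<^sub>R w) - f (p + h *\<^sub>R u) - f (p + h *\<^sub>R w) + f p = h * h * ?A z"
      using second_difference_mvt[OF e(2) f2 h, of u w] hm m by auto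
    obtain y where y: "dist p y \<le> h * (norm u + norm w)"
      "f (p + h *\<^sub>R w + h *\<^sub>R u) - f (p + h *\<^sub>R w) - f (p + h *\<^sub>R u) + f p = h * h * ?B y"
      using second_difference_mvt[OF e(2) f2 h, of w u] hm m by (auto simp: add.commute)
    have swap: "p + h *\<^sub>R w + h *\<^sub>R u = p + h *\<^sub>R u + h *\<^sub>R w" by (simp add: algebra_simps)
    have "h * h * ?A z = h * h * ?B y"
      unfolding z(2)[symmetric] y(2)[symmetric] swap by simp
    then have "?A z = ?B y" using h by simp
    moreover have "\<bar>?A z - ?A p\<bar> < d" "\<bar>?B y - ?B p\<bar> < d"
      using e1(2)[of z] e2(2)[of y] z(1) y(1) hm m by (auto simp: dist_commute)
    moreover have "a \<noteq> b" if "\<bar>a - ?A p\<bar> < d" "\<bar>b - ?B p\<bar> < d" for a b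
      using that unfolding d_def by (simp add: abs_if field_simps split: if_splits)
    ultimately show False by blast
  qed
qed

section \<open>Charts and smooth functions on manifolds\<close>

text \<open>What is needed of an atlas; unlike \<open>smooth_manifold\<close>, it passes to products at once.\<close>

definition open_charts :: "('p, 'e::euclidean_space) manifold \<Rightarrow> bool" where
  "open_charts M \<longleftrightarrow> (\<forall>(U, \<phi>)\<in>atlas M. openin (mtop M) U \<and> inj_on \<phi> U \<and>
     (\<forall>A. openin (mtop M) A \<longrightarrow> open (\<phi> ` (U \<inter> A))))"

lemma open_chartsD:
  assumes "open_charts M" "(U, \<phi>) \<in> atlas M"
  shows "openin (mtop M) U" "inj_on \<phi> U" "openin (mtop M) A \<Longrightarrow> open (\<phi> ` (U \<inter> A))"
  using assms by (auto simp: open_charts_def)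

lemma smooth_manifold_open_charts:
  assumes "smooth_manifold M"
  shows "open_charts M"
  unfolding open_charts_def
proof safe
  fix U \<phi> assume c: "(U, \<phi>) \<in> atlas M"
  have U: "openin (mtop M) U" "open (\<phi> ` U)"
    "homeomorphic_map (subtopology (mtop M) U) (top_of_set (\<phi> ` U)) \<phi>"
    using assms c by (auto simp: smooth_manifold_def)
  show "openin (mtop M) U" by fact
  have "U \<subseteq> topspace (mtop M)" using U(1) openin_subset by blast
  then show "inj_on \<phi> U"
    using homeomorphic_imp_injective_map[OF U(3)] by (simp add: topspace_subtopology Int_absorb1)
  fix A assume "openin (mtop M) A"
  then have "openin (subtopology (mtop M) U) (U \<inter> A)"
    by (simp add: openin_subtopology_Int2)
  then have "openin (top_of_set (\<phi> ` U)) (\<phi> ` (U \<inter> A))"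
    using homeomorphic_imp_open_map[OF U(3)] by (simp add: open_map_def)
  then show "open (\<phi> ` (U \<inter> A))"
    using U(2) openin_open_trans by blast
qed

lemma smooth_manifold_chart_at:
  assumes "smooth_manifold M" "p \<in> pts M"
  obtains U \<phi> where "(U, \<phi>) \<in> atlas M" "p \<in> U"
  using assms unfolding smooth_manifold_def by blast

lemma prod_manifold_open_charts:
  assumes "open_charts M" "open_charts N"
  shows "open_charts (prod_manifold M N)"
  unfolding open_charts_def
proof safe
  fix R \<rho> assume "(R, \<rho>) \<in> atlas (prod_manifold M N)"
  then obtain U \<phi> V \<psi> where c: "R = U \<times> V" "\<rho> = map_prod \<phi> \<psi>"
    "(U, \<phi>) \<in> atlas M" "(V, \<psi>) \<in> atlas N"
    by (auto simp: prod_manifold_def)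
  note U = open_chartsD[OF assms(1) c(3)] and V = open_chartsD[OF assms(2) c(4)]
  show "openin (mtop (prod_manifold M N)) R"
    using U(1) V(1) by (simp add: prod_manifold_def c openin_prod_Times_iff)
  show "inj_on \<rho> R"
    using U(2) V(2) by (auto simp: c inj_on_def)
  fix A assume "openin (mtop (prod_manifold M N)) A"
  then have A: "openin (prod_topology (mtop M) (mtop N)) A" by (simp add: prod_manifold_def)
  show "open (\<rho> ` (R \<inter> A))"
  \<comment> \<open>Open sets of the product need not be boxes, but the image of a box under
    \<open>map_prod\<close> is a box, so openness is checked around each point.\<close>
  proof (subst open_subopen, intro ballI)
    fix y assume "y \<in> \<rho> ` (R \<inter> A)"
    then obtain a b where ab: "y = \<rho> (a, b)" "(a, b) \<in> R" "(a, b) \<in> A" by auto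
    from A[unfolded openin_prod_topology_alt, rule_format, OF ab(3)]
    obtain P P' where P: "openin (mtop M) P" "openin (mtop N) P'" "a \<in> P" "b \<in> P'"
      "P \<times> P' \<subseteq> A"
      by blast
    have "open (\<phi> ` (U \<inter> P) \<times> \<psi> ` (V \<inter> P'))"
      using U(3) V(3) P by (intro open_Times) auto
    moreover have "\<rho> (a, b) \<in> \<phi> ` (U \<inter> P) \<times> \<psi> ` (V \<inter> P')"
      using P ab by (auto simp: c)
    moreover have "\<phi> ` (U \<inter> P) \<times> \<psi> ` (V \<inter> P') \<subseteq> \<rho> ` (R \<inter> A)"
    proof
      fix z assume "z \<in> \<phi> ` (U \<inter> P) \<times> \<psi> ` (V \<inter> P')"
      then obtain s t where "s \<in> U \<inter> P" "t \<in> V \<inter> P'" "z = \<rho> (s, t)" by (auto simp: c)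
      then show "z \<in> \<rho> ` (R \<inter> A)" using P(5) by (intro image_eqI[of _ _ "(s, t)"]) (auto simp: c)
    qed
    ultimately show "\<exists>T. open T \<and> y \<in> T \<and> T \<subseteq> \<rho> ` (R \<inter> A)"
      unfolding ab(1) by (intro exI conjI)
  qed
qed

lemma smooth_fun_cong:
  assumes "open_charts M" "openin (mtop M) W" "\<And>p. p \<in> W \<Longrightarrow> f p = g p" "smooth_fun M W f"
  shows "smooth_fun M W g"
  unfolding smooth_fun_def
proof safe
  fix U \<phi> assume c: "(U, \<phi>) \<in> atlas M"
  show "smooth_on (\<phi> ` (U \<inter> W)) (g \<circ> inv_into U \<phi>)"
    by (rule smooth_on_cong[where f = "f \<circ> inv_into U \<phi>"])
      (use assms c open_chartsD[OF assms(1) c] in \<open>auto simp: smooth_fun_def\<close>)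
qed

lemma smooth_fun_subset:
  assumes "smooth_fun M W f" "W' \<subseteq> W"
  shows "smooth_fun M W' f"
  unfolding smooth_fun_def
proof safe
  fix U \<phi> assume "(U, \<phi>) \<in> atlas M"
  then have "smooth_on (\<phi> ` (U \<inter> W)) (f \<circ> inv_into U \<phi>)"
    using assms(1) unfolding smooth_fun_def by blast
  then show "smooth_on (\<phi> ` (U \<inter> W')) (f \<circ> inv_into U \<phi>)"
    by (rule smooth_on_subset) (use assms(2) in auto)
qed

lemma smooth_fun_const: "smooth_fun M W (\<lambda>p. c)"
  by (auto simp: smooth_fun_def o_def smooth_on_const)

lemma smooth_fun_add:
  assumes "open_charts M" "openin (mtop M) W" "smooth_fun M W f" "smooth_fun M W g"
  shows "smooth_fun M W (\<lambda>p. f p + g p)"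
  unfolding smooth_fun_def
proof safe
  fix U \<phi> assume c: "(U, \<phi>) \<in> atlas M"
  have "smooth_on (\<phi> ` (U \<inter> W)) (f \<circ> inv_into U \<phi>)" "smooth_on (\<phi> ` (U \<inter> W)) (g \<circ> inv_into U \<phi>)"
    using assms(3,4) c unfolding smooth_fun_def by blast+
  from smooth_on_add[OF open_chartsD(3)[OF assms(1) c assms(2)] this]
  show "smooth_on (\<phi> ` (U \<inter> W)) ((\<lambda>p. f p + g p) \<circ> inv_into U \<phi>)"
    by (simp add: comp_def)
qed

lemma smooth_fun_mult:
  assumes "open_charts M" "openin (mtop M) W" "smooth_fun M W f" "smooth_fun M W g"
  shows "smooth_fun M W (\<lambda>p. f p * g p)"
  unfolding smooth_fun_def
proof safe
  fix U \<phi> assume c: "(U, \<phi>) \<in> atlas M"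
  have "smooth_on (\<phi> ` (U \<inter> W)) (f \<circ> inv_into U \<phi>)" "smooth_on (\<phi> ` (U \<inter> W)) (g \<circ> inv_into U \<phi>)"
    using assms(3,4) c unfolding smooth_fun_def by blast+
  from smooth_on_mult[OF open_chartsD(3)[OF assms(1) c assms(2)] this]
  show "smooth_on (\<phi> ` (U \<inter> W)) ((\<lambda>p. f p * g p) \<circ> inv_into U \<phi>)"
    by (simp add: comp_def)
qed

lemma smooth_fun_inverse:
  assumes "open_charts M" "openin (mtop M) W" "smooth_fun M W f" "\<And>p. p \<in> W \<Longrightarrow> f p \<noteq> 0"
  shows "smooth_fun M W (\<lambda>p. inverse (f p))"
  unfolding smooth_fun_def
proof safe
  fix U \<phi> assume c: "(U, \<phi>) \<in> atlas M"
  have "smooth_on (\<phi> ` (U \<inter> W)) (\<lambda>x. f (inv_into U \<phi> x))"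
    using assms(3) c unfolding smooth_fun_def comp_def by blast
  then have "smooth_on (\<phi> ` (U \<inter> W)) (\<lambda>x. inverse (f (inv_into U \<phi> x)))"
    using assms(2,4) open_chartsD[OF assms(1) c] by (intro smooth_on_inverse) auto
  then show "smooth_on (\<phi> ` (U \<inter> W)) ((\<lambda>p. inverse (f p)) \<circ> inv_into U \<phi>)"
    by (simp add: o_def)
qed

lemma smooth_fun_sum:
  assumes "open_charts M" "openin (mtop M) W" "\<And>i. i \<in> I \<Longrightarrow> smooth_fun M W (f i)"
  shows "smooth_fun M W (\<lambda>p. \<Sum>i\<in>I. f i p)"
  using assms(3)
proof (induction I rule: infinite_finite_induct)
  case (insert i I)
  then show ?case using smooth_fun_add[OF assms(1,2), of "f i"] by simp
qed (simp_all add: smooth_fun_const)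

lemma smooth_fun_prod:
  assumes "open_charts M" "openin (mtop M) W" "\<And>i. i \<in> I \<Longrightarrow> smooth_fun M W (f i)"
  shows "smooth_fun M W (\<lambda>p. \<Prod>i\<in>I. f i p)"
  using assms(3)
proof (induction I rule: infinite_finite_induct)
  case (insert i I)
  then show ?case using smooth_fun_mult[OF assms(1,2), of "f i"] by simp
qed (simp_all add: smooth_fun_const)

section \<open>Smooth dependence of inverse matrices\<close>

lemma smooth_fun_det:
  fixes A :: "'p \<Rightarrow> real^'m^'m"
  assumes "open_charts M" "openin (mtop M) W" "\<And>i j. smooth_fun M W (\<lambda>p. A p $ i $ j)"
  shows "smooth_fun M W (\<lambda>p. det (A p))"
  unfolding det_def
  by (rule smooth_fun_sum[OF assms(1,2)])
    (rule smooth_fun_mult[OF assms(1,2) smooth_fun_const smooth_fun_prod[OF assms]])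

lemma matrix_inv_inverse:
  assumes "invertible A"
  shows "A ** matrix_inv A = mat 1" "matrix_inv A ** A = mat 1"
proof -
  have "A ** matrix_inv A = mat 1 \<and> matrix_inv A ** A = mat 1"
    using assms unfolding matrix_inv_def invertible_def by (rule someI_ex)
  then show "A ** matrix_inv A = mat 1" "matrix_inv A ** A = mat 1" by auto
qed

text \<open>Column \<open>b\<close> of the inverse solves \<open>A *v y = axis b 1\<close>. Cramer's
  rule expresses its entries by determinants, which are visibly smooth in the entries of
  \<open>A\<close>.\<close>

lemma matrix_inv_cramer:
  fixes A :: "real^'m^'m"
  assumes "invertible A"
  shows "matrix_inv A $ a $ b =
    det (\<chi> i j. if j = a then axis b 1 $ i else A $ i $ j) * inverse (det A)"
proof -
  have "A *v (matrix_inv A *v axis b 1) = axis b 1"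
    by (simp add: matrix_vector_mul_assoc matrix_inv_inverse(1)[OF assms])
  then have "matrix_inv A *v axis b 1 =
      (\<chi> k. det (\<chi> i j. if j = k then axis b 1 $ i else A $ i $ j) / det A)"
    using cramer[of A] assms by (simp add: invertible_det_nz)
  then have "(matrix_inv A *v axis b 1) $ a =
      det (\<chi> i j. if j = a then axis b 1 $ i else A $ i $ j) / det A"
    by simp
  then show ?thesis by (simp add: matrix_vector_mult_basis column_def divide_inverse)
qed

lemma smooth_fun_matrix_inv:
  fixes A :: "'p \<Rightarrow> real^'m^'m"
  assumes M: "open_charts M" and W: "openin (mtop M) W"
    and A: "\<And>i j. smooth_fun M W (\<lambda>p. A p $ i $ j)" and inv: "\<And>p. p \<in> W \<Longrightarrow> invertible (A p)"
  shows "smooth_fun M W (\<lambda>p. matrix_inv (A p) $ a $ b)"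
proof (rule smooth_fun_cong[OF M W])
  show "det (\<chi> i j. if j = a then axis b 1 $ i else A p $ i $ j) * inverse (det (A p))
      = matrix_inv (A p) $ a $ b" if "p \<in> W" for p
    using matrix_inv_cramer[OF inv[OF that]] by simp
  have "smooth_fun M W (\<lambda>p. (\<chi> i j. if j = a then axis b 1 $ i else A p $ i $ j) $ i $ j)" for i j
    using A[of i j] by (cases "j = a") (simp_all add: smooth_fun_const)
  moreover have "det (A p) \<noteq> 0" if "p \<in> W" for p
    using inv[OF that] by (simp add: invertible_det_nz)
  ultimately show "smooth_fun M W (\<lambda>p. det (\<chi> i j. if j = a then axis b 1 $ i else A p $ i $ j)
      * inverse (det (A p)))"
    by (intro smooth_fun_mult[OF M W] smooth_fun_inverse[OF M W] smooth_fun_det[OF M W] A)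
qed

lemma openin_Int_vimage:
  assumes "openin X W" "continuous_map (subtopology X W) Y F" "openin Y W'"
  shows "openin X (W \<inter> F -` W')"
proof -
  have "openin (subtopology X W) {x \<in> topspace (subtopology X W). F x \<in> W'}"
    using assms(2,3) by (rule openin_continuous_map_preimage)
  moreover have "{x \<in> topspace (subtopology X W). F x \<in> W'} = W \<inter> F -` W'"
    using openin_subset[OF assms(1)] by auto
  ultimately show ?thesis using assms(1) by (metis openin_trans_full)
qed

lemma smooth_map_openin:
  "openin (mtop M) W \<Longrightarrow> smooth_map M W N F \<Longrightarrow> openin (mtop N) W' \<Longrightarrow> openin (mtop M) (W \<inter> F -` W')"
  unfolding smooth_map_def by (elim conjE) (rule openin_Int_vimage)

lemma smooth_fun_compose:
  assumes M: "open_charts M" and W: "openin (mtop M) W" and N: "smooth_manifold N"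
    and F: "smooth_map M W N F" and W': "openin (mtop N) W'" and f: "smooth_fun N W' f"
  shows "smooth_fun M (W \<inter> F -` W') (f \<circ> F)"
  unfolding smooth_fun_def
proof safe
  fix V \<psi> assume c: "(V, \<psi>) \<in> atlas M"
  note V = open_chartsD[OF M c]
  show "smooth_on (\<psi> ` (V \<inter> (W \<inter> F -` W'))) (f \<circ> F \<circ> inv_into V \<psi>)"
  proof (rule smooth_on_local)
    fix x assume "x \<in> \<psi> ` (V \<inter> (W \<inter> F -` W'))"
    then obtain p where p: "x = \<psi> p" "p \<in> V" "p \<in> W" "F p \<in> W'" by auto
    then have "F p \<in> pts N" using W' openin_subset by blast
    then obtain U \<phi> where d: "(U, \<phi>) \<in> atlas N" "F p \<in> U"
      using N smooth_manifold_chart_at by metis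
    note U = open_chartsD[OF smooth_manifold_open_charts[OF N] d(1)]
    \<comment> \<open>Shrunk so that \<open>F\<close> lands in a single chart of \<open>N\<close>;
      there the map factors through that chart.\<close>
    define T where "T = \<psi> ` (V \<inter> (W \<inter> F -` (W' \<inter> U)))"
    have "open T"
      unfolding T_def by (intro V(3) smooth_map_openin[OF W F] openin_Int W' U(1))
    moreover have "x \<in> T" using p d by (auto simp: T_def)
    moreover have "smooth_on T (f \<circ> F \<circ> inv_into V \<psi>)"
    proof (rule smooth_on_cong[OF \<open>open T\<close>])
      show "smooth_on T (\<lambda>y. (f \<circ> inv_into U \<phi>) ((\<phi> \<circ> F \<circ> inv_into V \<psi>) y))"
      proof (rule smooth_on_compose[OF \<open>open T\<close>, where f = "\<phi> \<circ> F \<circ> inv_into V \<psi>"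
            and g = "f \<circ> inv_into U \<phi>" and T = "\<phi> ` (U \<inter> W')"])
        show "(\<phi> \<circ> F \<circ> inv_into V \<psi>) ` T \<subseteq> \<phi> ` (U \<inter> W')"
          using V(2) by (auto simp: T_def)
        have "smooth_on (\<psi> ` (V \<inter> W \<inter> F -` U)) (\<phi> \<circ> F \<circ> inv_into V \<psi>)"
          using F c d unfolding smooth_map_def by blast
        then show "smooth_on T (\<phi> \<circ> F \<circ> inv_into V \<psi>)"
          by (rule smooth_on_subset) (auto simp: T_def)
        show "smooth_on (\<phi> ` (U \<inter> W')) (f \<circ> inv_into U \<phi>)"
          using f d unfolding smooth_fun_def by blast
      qed
    qed (use V(2) U(2) in \<open>auto simp: T_def\<close>)
    ultimately show "\<exists>T. open T \<and> x \<in> T \<and> smooth_on T (f \<circ> F \<circ> inv_into V \<psi>)" by blast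
  qed
qed

section \<open>Functions smooth near a point\<close>

lemma smooth_nearI: "openin (mtop M) W \<Longrightarrow> p \<in> W \<Longrightarrow> smooth_fun M W f \<Longrightarrow> smooth_near M p f"
  unfolding smooth_near_def by blast

lemma smooth_near2E:
  assumes "smooth_near M p f" "smooth_near M p g"
  obtains W where "openin (mtop M) W" "p \<in> W" "smooth_fun M W f" "smooth_fun M W g"
proof -
  obtain W1 W2 where "openin (mtop M) W1" "p \<in> W1" "smooth_fun M W1 f"
    "openin (mtop M) W2" "p \<in> W2" "smooth_fun M W2 g"
    using assms unfolding smooth_near_def by blast
  then show ?thesis
    by (intro that[of "W1 \<inter> W2"]) (auto intro: openin_Int smooth_fun_subset)
qed

lemma smooth_near_const: "p \<in> pts M \<Longrightarrow> smooth_near M p (\<lambda>r. c)"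
  by (rule smooth_nearI[of M "topspace (mtop M)"]) (auto intro: smooth_fun_const)

lemma smooth_near_add:
  assumes "open_charts M" "smooth_near M p f" "smooth_near M p g"
  shows "smooth_near M p (\<lambda>r. f r + g r)"
proof -
  obtain W where "openin (mtop M) W" "p \<in> W" "smooth_fun M W f" "smooth_fun M W g"
    using assms(2,3) by (rule smooth_near2E)
  then show ?thesis by (intro smooth_nearI[of M W] smooth_fun_add assms(1))
qed

lemma smooth_near_mult:
  assumes "open_charts M" "smooth_near M p f" "smooth_near M p g"
  shows "smooth_near M p (\<lambda>r. f r * g r)"
proof -
  obtain W where "openin (mtop M) W" "p \<in> W" "smooth_fun M W f" "smooth_fun M W g"
    using assms(2,3) by (rule smooth_near2E)
  then show ?thesis by (intro smooth_nearI[of M W] smooth_fun_mult assms(1))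
qed

lemma smooth_near_sum:
  assumes "open_charts M" "p \<in> pts M" "\<And>i. i \<in> I \<Longrightarrow> smooth_near M p (f i)"
  shows "smooth_near M p (\<lambda>r. \<Sum>i\<in>I. f i r)"
  using assms(3)
proof (induction I rule: infinite_finite_induct)
  case (insert i I)
  then show ?case using smooth_near_add[OF assms(1), of p "f i"] by simp
qed (simp_all add: smooth_near_const[OF assms(2)])

lemma smooth_near_cong:
  assumes "open_charts M" "openin (mtop M) W" "p \<in> W" "\<And>r. r \<in> W \<Longrightarrow> f r = g r"
    and "smooth_near M p f"
  shows "smooth_near M p g"
proof -
  obtain W1 where W1: "openin (mtop M) W1" "p \<in> W1" "smooth_fun M W1 f"
    using assms(5) unfolding smooth_near_def by blast
  have o: "openin (mtop M) (W1 \<inter> W)" using W1 assms(2) by blast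
  show ?thesis
    by (rule smooth_nearI[OF o _ smooth_fun_cong[OF assms(1) o _ smooth_fun_subset[OF W1(3)]]])
      (use W1 assms in auto)
qed

lemma smooth_near_compose:
  assumes "open_charts M" "openin (mtop M) W" "smooth_manifold N" "smooth_map M W N F" "p \<in> W"
    and "smooth_near N (F p) f"
  shows "smooth_near M p (f \<circ> F)"
proof -
  obtain W' where W': "openin (mtop N) W'" "F p \<in> W'" "smooth_fun N W' f"
    using assms(6) unfolding smooth_near_def by blast
  show ?thesis
    by (rule smooth_nearI[OF smooth_map_openin[OF assms(2,4) W'(1)] _
        smooth_fun_compose[OF assms(1-4) W'(1,3)]]) (use W' assms in auto)
qed

section \<open>Tangent vectors\<close>

text \<open>Reduces the rules for tangent vectors to those of \<open>has_derivative\<close> for the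
  function read in the chart.\<close>

lemma coord_vec_has_derivative:
  assumes "open_charts M" "(U, \<phi>) \<in> atlas M" "p \<in> U" "smooth_near M p f"
  shows "((f \<circ> inv_into U \<phi>) has_derivative (\<lambda>u. coord_vec M (U, \<phi>) p u f)) (at (\<phi> p))"
proof -
  obtain W where W: "openin (mtop M) W" "p \<in> W" "smooth_fun M W f"
    using assms(4) unfolding smooth_near_def by blast
  then have "smooth_on (\<phi> ` (U \<inter> W)) (f \<circ> inv_into U \<phi>)"
    using assms(2) unfolding smooth_fun_def by blast
  from smooth_on_has_derivative[OF this, of "\<phi> p"] show ?thesis
    using assms(3,4) W(2) by (auto simp: coord_vec_def)
qed

lemma coord_vec_eqI:
  assumes "open_charts M" "(U, \<phi>) \<in> atlas M" "p \<in> U" "smooth_near M p f"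
    and "((f \<circ> inv_into U \<phi>) has_derivative f') (at (\<phi> p))"
  shows "coord_vec M (U, \<phi>) p u f = f' u"
  using has_derivative_unique[OF coord_vec_has_derivative[OF assms(1-4)] assms(5)] by metis

lemma tangent_spaceE:
  assumes "v \<in> tangent_space M p"
  obtains U \<phi> u where "(U, \<phi>) \<in> atlas M" "p \<in> U" "v = coord_vec M (U, \<phi>) p u"
  using assms unfolding tangent_space_def by auto

lemma tangent_space_pts:
  assumes "open_charts M" "v \<in> tangent_space M p"
  shows "p \<in> pts M"
proof -
  obtain U \<phi> u where "(U, \<phi>) \<in> atlas M" "p \<in> U"
    using assms(2) by (rule tangent_spaceE)
  then show ?thesis using openin_subset[OF open_chartsD(1)[OF assms(1)]] by blast
qed

lemma tangent_not_smooth: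
  assumes "v \<in> tangent_space M p" "\<not> smooth_near M p f"
  shows "v f = 0"
  using assms by (auto elim!: tangent_spaceE simp: coord_vec_def)

lemma tangent_const:
  assumes "open_charts M" "v \<in> tangent_space M p"
  shows "v (\<lambda>r. c) = 0"
proof -
  obtain U \<phi> u where v: "(U, \<phi>) \<in> atlas M" "p \<in> U" "v = coord_vec M (U, \<phi>) p u"
    using assms(2) by (rule tangent_spaceE)
  show ?thesis
    unfolding v(3)
    using coord_vec_eqI[OF assms(1) v(1,2) smooth_near_const, of c "\<lambda>u. 0" u]
      tangent_space_pts[OF assms] by (simp add: o_def)
qed

lemma tangent_add:
  assumes "open_charts M" "v \<in> tangent_space M p" "smooth_near M p f" "smooth_near M p g"
  shows "v (\<lambda>r. f r + g r) = v f + v g"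
proof -
  obtain U \<phi> u where v: "(U, \<phi>) \<in> atlas M" "p \<in> U" "v = coord_vec M (U, \<phi>) p u"
    using assms(2) by (rule tangent_spaceE)
  note d = coord_vec_has_derivative[OF assms(1) v(1,2)]
  show ?thesis
    unfolding v(3)
    by (rule coord_vec_eqI[OF assms(1) v(1,2) smooth_near_add[OF assms(1,3,4)]])
      (use has_derivative_add[OF d[OF assms(3)] d[OF assms(4)]] in \<open>simp add: o_def\<close>)
qed

lemma tangent_mult:
  assumes "open_charts M" "v \<in> tangent_space M p" "smooth_near M p f" "smooth_near M p g"
  shows "v (\<lambda>r. f r * g r) = f p * v g + v f * g p"
proof -
  obtain U \<phi> u where v: "(U, \<phi>) \<in> atlas M" "p \<in> U" "v = coord_vec M (U, \<phi>) p u"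
    using assms(2) by (rule tangent_spaceE)
  note d = coord_vec_has_derivative[OF assms(1) v(1,2)]
  have "inv_into U \<phi> (\<phi> p) = p" using open_chartsD(2)[OF assms(1) v(1)] v(2) by simp
  then show ?thesis
    unfolding v(3)
    by (intro coord_vec_eqI[OF assms(1) v(1,2) smooth_near_mult[OF assms(1,3,4)]])
      (use has_derivative_mult[OF d[OF assms(3)] d[OF assms(4)]] in \<open>simp add: o_def\<close>)
qed

lemma tangent_sum:
  assumes "open_charts M" "v \<in> tangent_space M p" "\<And>i. i \<in> I \<Longrightarrow> smooth_near M p (f i)"
  shows "v (\<lambda>r. \<Sum>i\<in>I. f i r) = (\<Sum>i\<in>I. v (f i))"
  using assms(3)
proof (induction I rule: infinite_finite_induct)
  case (insert i I)
  have "smooth_near M p (\<lambda>r. \<Sum>i\<in>I. f i r)"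
    using insert.prems by (intro smooth_near_sum assms(1) tangent_space_pts[OF assms(1,2)]) auto
  moreover have "v (\<lambda>r. \<Sum>i\<in>I. f i r) = (\<Sum>i\<in>I. v (f i))"
    by (rule insert.IH) (rule insert.prems, simp)
  ultimately show ?case
    using tangent_add[OF assms(1,2) insert.prems[OF insertI1], of "\<lambda>r. \<Sum>i\<in>I. f i r"] insert.hyps
    by simp
qed (simp_all add: tangent_const[OF assms(1,2)])

lemma tangent_cmult:
  assumes "open_charts M" "v \<in> tangent_space M p" "smooth_near M p f"
  shows "v (\<lambda>r. c * f r) = c * v f"
  using tangent_mult[OF assms(1,2) smooth_near_const assms(3), of c] tangent_const[OF assms(1,2)]
    tangent_space_pts[OF assms(1,2)] by simp

lemma tangent_cong:
  assumes "open_charts M" "v \<in> tangent_space M p" "openin (mtop M) W" "p \<in> W"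
    and "\<And>r. r \<in> W \<Longrightarrow> f r = g r"
  shows "v f = v g"
proof (cases "smooth_near M p f")
  case True
  have g: "smooth_near M p g" by (rule smooth_near_cong[OF assms(1,3-5) True])
  obtain U \<phi> u where v: "(U, \<phi>) \<in> atlas M" "p \<in> U" "v = coord_vec M (U, \<phi>) p u"
    using assms(2) by (rule tangent_spaceE)
  note U = open_chartsD[OF assms(1) v(1)]
  show ?thesis
    unfolding v(3)
  proof (rule coord_vec_eqI[OF assms(1) v(1,2) True])
    show "(f \<circ> inv_into U \<phi> has_derivative (\<lambda>u. coord_vec M (U, \<phi>) p u g)) (at (\<phi> p))"
      by (rule has_derivative_transform_within_open
          [OF coord_vec_has_derivative[OF assms(1) v(1,2) g] U(3)[OF assms(3)]])
        (use U(2) v(2) assms(4,5) in auto)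
  qed
next
  \<comment> \<open>Smoothness near \<open>p\<close> depends on the germ only, so both functions
    fail it and both sides are the default value 0.\<close>
  case False
  then have "\<not> smooth_near M p g"
    using smooth_near_cong[OF assms(1,3,4), of g f] assms(5) by metis
  with False show ?thesis using tangent_not_smooth[OF assms(2)] by simp
qed

text \<open>The chain rule in charts. For the identity map it becomes the change of charts for
  tangent vectors.\<close>

lemma tangent_map_coord_vec:
  assumes M: "open_charts M" and W: "openin (mtop M) W" and N: "smooth_manifold N"
    and F: "smooth_map M W N F" and p: "p \<in> W" "p \<in> V" and c: "(V, \<psi>) \<in> atlas M"
    and d: "(U, \<phi>) \<in> atlas N" "F p \<in> U"
  shows "tangent_map N F p (coord_vec M (V, \<psi>) p u) =
    coord_vec N (U, \<phi>) (F p) (frechet_derivative (\<phi> \<circ> F \<circ> inv_into V \<psi>) (at (\<psi> p)) u)"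
proof
  fix f
  note NC = smooth_manifold_open_charts[OF N]
  note V = open_chartsD[OF M c] and U = open_chartsD[OF NC d(1)]
  show "tangent_map N F p (coord_vec M (V, \<psi>) p u) f =
    coord_vec N (U, \<phi>) (F p) (frechet_derivative (\<phi> \<circ> F \<circ> inv_into V \<psi>) (at (\<psi> p)) u) f"
  proof (cases "smooth_near N (F p) f")
    case True
    define T where "T = \<psi> ` (V \<inter> (W \<inter> F -` U))"
    have T: "open T" "\<psi> p \<in> T"
      unfolding T_def using p d by (auto intro!: V(3) smooth_map_openin[OF W F] U(1))
    have "smooth_on (\<psi> ` (V \<inter> W \<inter> F -` U)) (\<phi> \<circ> F \<circ> inv_into V \<psi>)"
      using F c d unfolding smooth_map_def by blast
    then have 1: "(\<phi> \<circ> F \<circ> inv_into V \<psi> has_derivative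
        frechet_derivative (\<phi> \<circ> F \<circ> inv_into V \<psi>) (at (\<psi> p))) (at (\<psi> p))"
      by (rule smooth_on_has_derivative) (use p d in auto)
    have eq: "(\<phi> \<circ> F \<circ> inv_into V \<psi>) (\<psi> p) = \<phi> (F p)" using V(2) p by simp
    have 2: "((\<lambda>y. (f \<circ> inv_into U \<phi>) ((\<phi> \<circ> F \<circ> inv_into V \<psi>) y)) has_derivative
        (\<lambda>u. coord_vec N (U, \<phi>) (F p) (frechet_derivative (\<phi> \<circ> F \<circ> inv_into V \<psi>) (at (\<psi> p)) u) f))
        (at (\<psi> p))"
      by (rule has_derivative_compose[OF 1])
        (unfold eq, rule coord_vec_has_derivative[OF NC d True])
    have 3: "(f \<circ> F \<circ> inv_into V \<psi> has_derivative
        (\<lambda>u. coord_vec N (U, \<phi>) (F p) (frechet_derivative (\<phi> \<circ> F \<circ> inv_into V \<psi>) (at (\<psi> p)) u) f))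
        (at (\<psi> p))"
      by (rule has_derivative_transform_within_open[OF 2 T]) (use V(2) U(2) in \<open>auto simp: T_def\<close>)
    show ?thesis
      using coord_vec_eqI[OF M c p(2) smooth_near_compose[OF M W N F p(1) True] 3] True
      by (simp add: tangent_map_def)
  qed (simp add: tangent_map_def coord_vec_def)
qed

lemma tangent_map_in_tangent_space:
  assumes "open_charts M" "openin (mtop M) W" "smooth_manifold N" "smooth_map M W N F" "p \<in> W"
    and "v \<in> tangent_space M p" "F p \<in> pts N"
  shows "tangent_map N F p v \<in> tangent_space N (F p)"
proof -
  obtain V \<psi> u where v: "(V, \<psi>) \<in> atlas M" "p \<in> V" "v = coord_vec M (V, \<psi>) p u"
    using assms(6) by (rule tangent_spaceE)
  obtain U \<phi> where c: "(U, \<phi>) \<in> atlas N" "F p \<in> U"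
    using assms(3,7) by (rule smooth_manifold_chart_at)
  show ?thesis
    unfolding v(3) tangent_map_coord_vec[OF assms(1-5) v(2,1) c]
    using c by (auto simp: tangent_space_def)
qed

text \<open>\<open>tangent_space\<close> collects coordinate vectors of all charts around
  \<open>p\<close>. One chart suffices, which is what makes the tangent space closed under linear
  combinations.\<close>

lemma tangent_space_chart:
  assumes M: "smooth_manifold M" and c: "(U, \<phi>) \<in> atlas M" "p \<in> U" and v: "v \<in> tangent_space M p"
  obtains u where "v = coord_vec M (U, \<phi>) p u"
proof -
  note MC = smooth_manifold_open_charts[OF M]
  have id: "smooth_map M (pts M) M (\<lambda>r. r)"
    unfolding smooth_map_def
  proof safe
    fix A \<alpha> A' \<alpha>' assume a: "(A, \<alpha>) \<in> atlas M" "(A', \<alpha>') \<in> atlas M"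
    then have "smooth_on (\<alpha> ` (A \<inter> A')) (\<alpha>' \<circ> inv_into A \<alpha>)"
      using M unfolding smooth_manifold_def by blast
    then show "smooth_on (\<alpha> ` (A \<inter> pts M \<inter> (\<lambda>r. r) -` A')) (\<alpha>' \<circ> (\<lambda>r. r) \<circ> inv_into A \<alpha>)"
      unfolding comp_def by (rule smooth_on_subset) auto
  qed simp
  obtain V \<psi> u where v': "(V, \<psi>) \<in> atlas M" "p \<in> V" "v = coord_vec M (V, \<psi>) p u"
    using v by (rule tangent_spaceE)
  \<comment> \<open>Holds as an equality of operators because \<open>v\<close> is 0 on functions not
    smooth near \<open>p\<close>, just as \<open>tangent_map\<close> is by its definition.\<close>
  have "tangent_map M (\<lambda>r. r) p v = v"
    using tangent_not_smooth[OF v] by (auto simp: tangent_map_def o_def)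
  then show ?thesis
    using tangent_map_coord_vec[OF MC openin_topspace M id tangent_space_pts[OF MC v] v'(2,1) c, of u]
      v'(3) that by metis
qed

lemma tangent_space_combination:
  assumes M: "smooth_manifold M" and u: "u \<in> tangent_space M p" and v: "v \<in> tangent_space M p"
  shows "(\<lambda>f. a * u f + b * v f) \<in> tangent_space M p"
proof -
  note MC = smooth_manifold_open_charts[OF M]
  obtain U \<phi> where c: "(U, \<phi>) \<in> atlas M" "p \<in> U"
    using M tangent_space_pts[OF MC u] by (rule smooth_manifold_chart_at)
  obtain s t where s: "u = coord_vec M (U, \<phi>) p s" and t: "v = coord_vec M (U, \<phi>) p t"
    using tangent_space_chart[OF M c u] tangent_space_chart[OF M c v] by metis
  have "(\<lambda>f. a * u f + b * v f) = coord_vec M (U, \<phi>) p (a *\<^sub>R s + b *\<^sub>R t)"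
  proof
    fix f
    show "a * u f + b * v f = coord_vec M (U, \<phi>) p (a *\<^sub>R s + b *\<^sub>R t) f"
    proof (cases "smooth_near M p f")
      case True
      have "linear (\<lambda>u. coord_vec M (U, \<phi>) p u f)"
        using has_derivative_linear[OF coord_vec_has_derivative[OF MC c True]] .
      from linear_add[OF this, of "a *\<^sub>R s" "b *\<^sub>R t"] linear_scale[OF this]
      show ?thesis unfolding s t by simp
    qed (simp add: s t coord_vec_def)
  qed
  then show ?thesis using c by (auto simp: tangent_space_def)
qed

lemma tangent_space_lincomb:
  assumes M: "smooth_manifold M" and p: "p \<in> pts M"
    and Y: "\<And>i. i \<in> I \<Longrightarrow> Y i \<in> tangent_space M p"
  shows "lincomb I c Y \<in> tangent_space M p"
proof -
  note MC = smooth_manifold_open_charts[OF M]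
  obtain U \<phi> where d: "(U, \<phi>) \<in> atlas M" "p \<in> U"
    using M p by (rule smooth_manifold_chart_at)
  have v: "coord_vec M (U, \<phi>) p 0 \<in> tangent_space M p" using d by (auto simp: tangent_space_def)
  have zero: "(\<lambda>f. 0) \<in> tangent_space M p"
    using tangent_space_combination[OF M v v, of 0 0] by simp
  show ?thesis
    using Y
  proof (induction I rule: infinite_finite_induct)
    case (insert i I)
    have "lincomb (insert i I) c Y = (\<lambda>f. c i * Y i f + 1 * lincomb I c Y f)"
      using insert.hyps by (simp add: lincomb_def)
    moreover have "lincomb I c Y \<in> tangent_space M p"
      by (rule insert.IH) (rule insert.prems, simp)
    ultimately show ?case
      using tangent_space_combination[OF M insert.prems[OF insertI1], of "lincomb I c Y" "c i" 1]
      by simp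
  qed (simp_all add: lincomb_def zero)
qed

section \<open>Vector fields and symmetric tensors\<close>

lemma vector_field_smooth_near:
  assumes "openin (mtop M) W" "vector_field M W X" "p \<in> W" "smooth_near M p f"
  shows "smooth_near M p (\<lambda>r. X r f)"
proof -
  obtain W' where W': "openin (mtop M) W'" "p \<in> W'" "smooth_fun M W' f"
    using assms(4) unfolding smooth_near_def by blast
  have "openin (mtop M) (W' \<inter> W)" using W' assms(1) by blast
  moreover have "smooth_fun M (W' \<inter> W) (\<lambda>r. X r f)"
    using calculation assms(2) smooth_fun_subset[OF W'(3), of "W' \<inter> W"] by (auto simp: vector_field_def)
  ultimately show ?thesis using W' assms(3) by (intro smooth_nearI[of M "W' \<inter> W"]) auto
qed

lemma vector_field_near:
  "openin (mtop M) W \<Longrightarrow> vector_field M W X \<Longrightarrow> p \<in> W \<Longrightarrow> vector_field_near M p X"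
  unfolding vector_field_near_def by blast

text \<open>The shape of \<open>Xv\<close>: a generator corrected by a combination of lifts with
  function coefficients.\<close>

lemma vector_field_add_scaled:
  assumes M: "smooth_manifold M" and W: "openin (mtop M) W"
    and X: "vector_field M W X" and Y: "\<And>i. i \<in> I \<Longrightarrow> vector_field M W (Y i)"
    and h: "\<And>i. i \<in> I \<Longrightarrow> smooth_fun M W (h i)"
  shows "vector_field M W (\<lambda>p f. X p f + (\<Sum>i\<in>I. h i p * Y i p f))"
  unfolding vector_field_def
proof (intro conjI ballI allI impI)
  fix p assume p: "p \<in> W"
  have "lincomb I (\<lambda>i. h i p) (\<lambda>i. Y i p) \<in> tangent_space M p"
    using Y p openin_subset[OF W] by (intro tangent_space_lincomb M) (auto simp: vector_field_def)
  then show "(\<lambda>f. X p f + (\<Sum>i\<in>I. h i p * Y i p f)) \<in> tangent_space M p"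
    using tangent_space_combination[OF M, of "X p" p "lincomb I (\<lambda>i. h i p) (\<lambda>i. Y i p)" 1 1] X p
    by (simp add: lincomb_def vector_field_def)
next
  fix W' f assume W': "openin (mtop M) W' \<and> W' \<subseteq> W \<and> smooth_fun M W' f"
  note MC = smooth_manifold_open_charts[OF M]
  have "smooth_fun M W' (\<lambda>p. X p f)"
    using X W' by (simp add: vector_field_def)
  moreover have "smooth_fun M W' (\<lambda>p. h i p * Y i p f)" if i: "i \<in> I" for i
  proof (rule smooth_fun_mult[OF MC])
    show "smooth_fun M W' (h i)" by (rule smooth_fun_subset[OF h[OF i]]) (simp add: W')
    show "smooth_fun M W' (\<lambda>p. Y i p f)" using Y[OF i] W' by (simp add: vector_field_def)
  qed (simp add: W')
  ultimately show "smooth_fun M W' (\<lambda>p. X p f + (\<Sum>i\<in>I. h i p * Y i p f))"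
    using W' by (intro smooth_fun_add smooth_fun_sum MC) simp_all
qed

lemma symmetric_tensor_linear:
  assumes "symmetric_tensor M g" "p \<in> pts M" "u \<in> tangent_space M p" "v \<in> tangent_space M p"
    and "w \<in> tangent_space M p"
  shows "g p (\<lambda>f. a * u f + b * v f) w = a * g p u w + b * g p v w"
proof -
  have "\<forall>p\<in>pts M. \<forall>u\<in>tangent_space M p. \<forall>v\<in>tangent_space M p. \<forall>w\<in>tangent_space M p. \<forall>a b.
      g p (\<lambda>f. a * u f + b * v f) w = a * g p u w + b * g p v w"
    using assms(1) unfolding symmetric_tensor_def by (elim conjE)
  then show ?thesis by (simp only: assms(2-))
qed

lemma symmetric_tensor_commute:
  assumes "symmetric_tensor M g" "p \<in> pts M" "u \<in> tangent_space M p" "v \<in> tangent_space M p"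
  shows "g p u v = g p v u"
  using assms unfolding symmetric_tensor_def by simp

lemma symmetric_tensor_lincomb:
  assumes M: "smooth_manifold M" and g: "symmetric_tensor M g" and p: "p \<in> pts M"
    and Y: "\<And>i. i \<in> I \<Longrightarrow> Y i \<in> tangent_space M p" and w: "w \<in> tangent_space M p"
  shows "g p (lincomb I c Y) w = (\<Sum>i\<in>I. c i * g p (Y i) w)"
proof -
  \<comment> \<open>Linearity is given for combinations of two vectors; zero coefficients supply the
    value on the empty sum.\<close>
  have zero: "g p (\<lambda>f. 0) w = 0"
    using symmetric_tensor_linear[OF g p w w w, of 0 0] by simp
  show ?thesis
    using Y
  proof (induction I rule: infinite_finite_induct)
    case (insert i I)
    have "lincomb (insert i I) c Y = (\<lambda>f. c i * Y i f + 1 * lincomb I c Y f)"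
      using insert.hyps by (simp add: lincomb_def)
    moreover have "Y i \<in> tangent_space M p" "lincomb I c Y \<in> tangent_space M p"
      by (auto intro: tangent_space_lincomb[OF M p] insert.prems)
    moreover have "g p (lincomb I c Y) w = (\<Sum>i\<in>I. c i * g p (Y i) w)"
      by (rule insert.IH) (rule insert.prems, simp)
    ultimately show ?case
      using insert.hyps symmetric_tensor_linear[OF g p _ _ w, of "Y i" "lincomb I c Y" "c i" 1] by simp
  qed (simp_all add: lincomb_def zero)
qed

section \<open>Slices of smooth maps on products\<close>

text \<open>The inclusions \<open>a \<mapsto> (a, b)\<close> and \<open>b \<mapsto> (a, b)\<close>
  are affine when read in product charts, so smoothness of both kinds of slices is an instance of
  this.\<close>

lemma smooth_map_compose_affine:
  assumes M: "open_charts M" and A: "openin (mtop M) A" and M': "open_charts M'"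
    and P: "smooth_manifold P" and F: "smooth_map M' A' P F"
    and j: "continuous_map (subtopology (mtop M) A) (subtopology (mtop M') A') j"
    and aff: "\<And>U \<phi>. (U, \<phi>) \<in> atlas M \<Longrightarrow> \<exists>U' \<phi>' c L. (U', \<phi>') \<in> atlas M' \<and> bounded_linear L \<and>
      (\<forall>a\<in>U \<inter> A. j a \<in> U' \<and> \<phi>' (j a) = c + L (\<phi> a))"
  shows "smooth_map M A P (\<lambda>a. F (j a))"
proof -
  have "continuous_map (subtopology (mtop M') A') (mtop P) F"
    using F unfolding smooth_map_def by (elim conjE)
  from continuous_map_compose[OF j this]
  have cont: "continuous_map (subtopology (mtop M) A) (mtop P) (\<lambda>a. F (j a))"
    by (simp add: comp_def)
  have jA: "j a \<in> A'" if "a \<in> A" for a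
    using continuous_map_image_subset_topspace[OF j] that openin_subset[OF A] by auto
  show ?thesis
    unfolding smooth_map_def
  proof (intro conjI cont ballI, clarify)
    fix U \<phi> V \<rho> assume U: "(U, \<phi>) \<in> atlas M" and V: "(V, \<rho>) \<in> atlas P"
    note UO = open_chartsD[OF M U]
    obtain U' \<phi>' c L where U': "(U', \<phi>') \<in> atlas M'" and L: "bounded_linear L"
      and *: "\<And>a. a \<in> U \<Longrightarrow> a \<in> A \<Longrightarrow> j a \<in> U' \<and> \<phi>' (j a) = c + L (\<phi> a)"
      using aff[OF U] by blast
    note UO' = open_chartsD[OF M' U']
    let ?S = "\<phi> ` (U \<inter> A \<inter> (\<lambda>a. F (j a)) -` V)"
    have "openin (mtop P) V"
      by (rule open_chartsD(1)[OF smooth_manifold_open_charts[OF P] V])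
    from UO(3)[OF openin_Int_vimage[OF A cont this]] have S: "open ?S"
      by (simp add: Int_assoc)
    have "smooth_on (\<phi>' ` (U' \<inter> A' \<inter> F -` V)) (\<rho> \<circ> F \<circ> inv_into U' \<phi>')"
      using F U' V unfolding smooth_map_def by fast
    moreover have "(\<lambda>y. c + L y) ` ?S \<subseteq> \<phi>' ` (U' \<inter> A' \<inter> F -` V)"
    proof clarify
      fix a assume a: "a \<in> U" "a \<in> A" "F (j a) \<in> V"
      then show "c + L (\<phi> a) \<in> \<phi>' ` (U' \<inter> A' \<inter> F -` V)"
        using *[OF a(1,2)] jA[OF a(2)] by (intro image_eqI[of _ _ "j a"]) auto
    qed
    ultimately have "smooth_on ?S (\<lambda>y. (\<rho> \<circ> F \<circ> inv_into U' \<phi>') (c + L y))"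
      using smooth_on_compose[OF S _ smooth_on_affine[OF S L]] by blast
    then show "smooth_on ?S (\<rho> \<circ> (\<lambda>a. F (j a)) \<circ> inv_into U \<phi>)"
    proof (rule smooth_on_cong[OF S, rotated])
      fix y assume "y \<in> ?S"
      then obtain a where a: "a \<in> U" "a \<in> A" "y = \<phi> a" by auto
      have "inv_into U' \<phi>' (c + L y) = j a"
        using *[OF a(1,2)] inv_into_f_f[OF UO'(2), of "j a"] a(3) by simp
      then show "(\<rho> \<circ> F \<circ> inv_into U' \<phi>') (c + L y) = (\<rho> \<circ> (\<lambda>a. F (j a)) \<circ> inv_into U \<phi>) y"
        using a UO(2) by simp
    qed
  qed
qed

lemma smooth_map_slice_left:
  assumes M: "open_charts M" and A: "openin (mtop M) A" and N: "smooth_manifold N"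
    and P: "smooth_manifold P" and F: "smooth_map (prod_manifold M N) (A \<times> B) P F"
    and b: "b \<in> B" "b \<in> pts N"
  shows "smooth_map M A P (\<lambda>a. F (a, b))"
proof (rule smooth_map_compose_affine[OF M A _ P F])
  note NC = smooth_manifold_open_charts[OF N]
  show "open_charts (prod_manifold M N)" by (rule prod_manifold_open_charts[OF M NC])
  show "continuous_map (subtopology (mtop M) A) (subtopology (mtop (prod_manifold M N)) (A \<times> B))
      (\<lambda>a. (a, b))"
    using b openin_subset[OF A]
    by (auto simp: prod_manifold_def continuous_map_in_subtopology continuous_map_pairwise comp_def
        intro: continuous_map_from_subtopology)
  fix U \<phi> assume U: "(U, \<phi>) \<in> atlas M"
  obtain V \<psi> where V: "(V, \<psi>) \<in> atlas N" "b \<in> V"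
    using N b(2) by (rule smooth_manifold_chart_at)
  have "(U \<times> V, map_prod \<phi> \<psi>) \<in> atlas (prod_manifold M N)"
    using U V by (auto simp: prod_manifold_def)
  moreover have "bounded_linear (\<lambda>y. (y, 0))"
    by (intro bounded_linear_Pair bounded_linear_ident bounded_linear_zero)
  moreover have "\<forall>a\<in>U \<inter> A. (a, b) \<in> U \<times> V \<and> map_prod \<phi> \<psi> (a, b) = (0, \<psi> b) + (\<phi> a, 0)"
    using V by simp
  ultimately show "\<exists>U' \<phi>' c L. (U', \<phi>') \<in> atlas (prod_manifold M N) \<and> bounded_linear L \<and>
      (\<forall>a\<in>U \<inter> A. (a, b) \<in> U' \<and> \<phi>' (a, b) = c + L (\<phi> a))"
    by (intro exI conjI)
qed

lemma smooth_map_slice_right: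
  assumes M: "smooth_manifold M" and B: "openin (mtop N) B" and N: "open_charts N"
    and P: "smooth_manifold P" and F: "smooth_map (prod_manifold M N) (A \<times> B) P F"
    and a: "a \<in> A" "a \<in> pts M"
  shows "smooth_map N B P (\<lambda>b. F (a, b))"
proof (rule smooth_map_compose_affine[OF N B _ P F])
  note MC = smooth_manifold_open_charts[OF M]
  show "open_charts (prod_manifold M N)" by (rule prod_manifold_open_charts[OF MC N])
  show "continuous_map (subtopology (mtop N) B) (subtopology (mtop (prod_manifold M N)) (A \<times> B))
      (\<lambda>b. (a, b))"
    using a openin_subset[OF B]
    by (auto simp: prod_manifold_def continuous_map_in_subtopology continuous_map_pairwise comp_def
        intro: continuous_map_from_subtopology)
  fix V \<psi> assume V: "(V, \<psi>) \<in> atlas N"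
  obtain U \<phi> where U: "(U, \<phi>) \<in> atlas M" "a \<in> U"
    using M a(2) by (rule smooth_manifold_chart_at)
  have "(U \<times> V, map_prod \<phi> \<psi>) \<in> atlas (prod_manifold M N)"
    using U V by (auto simp: prod_manifold_def)
  moreover have "bounded_linear (\<lambda>y. (0, y))"
    by (intro bounded_linear_Pair bounded_linear_ident bounded_linear_zero)
  moreover have "\<forall>b\<in>V \<inter> B. (a, b) \<in> U \<times> V \<and> map_prod \<phi> \<psi> (a, b) = (\<phi> a, 0) + (0, \<psi> b)"
    using U by simp
  ultimately show "\<exists>U' \<phi>' c L. (U', \<phi>') \<in> atlas (prod_manifold M N) \<and> bounded_linear L \<and>
      (\<forall>b\<in>V \<inter> B. (a, b) \<in> U' \<and> \<phi>' (a, b) = c + L (\<psi> b))"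
    by (intro exI conjI)
qed

section \<open>Infinitesimal generators\<close>

locale lie_group_action =
  fixes G :: "'g monoid" and GM :: "('g, 'h::euclidean_space) manifold"
    and Q :: "('q, 'e::euclidean_space) manifold" and act :: "'g \<Rightarrow> 'q \<Rightarrow> 'q"
  assumes lie: "lie_group G GM" and Q: "smooth_manifold Q"
    and free_proper: "free_proper_action G GM Q act"
begin

lemma G: "group G" and GM: "smooth_manifold GM" and pts_GM: "pts GM = carrier G"
  using lie by (simp_all add: lie_group_def)

lemmas QC = smooth_manifold_open_charts[OF Q] and GC = smooth_manifold_open_charts[OF GM]

lemma open_carrier: "openin (mtop GM) (carrier G)"
  using openin_topspace[of "mtop GM"] by (simp add: pts_GM)

lemma one_carrier: "\<one>\<^bsub>G\<^esub> \<in> carrier G"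
  using G by (simp add: group.is_monoid monoid.one_closed)

lemma act: "group_action G (pts Q) act"
  and act_smooth: "smooth_map (prod_manifold GM Q) (carrier G \<times> pts Q) Q (\<lambda>(h, q). act h q)"
  using free_proper by (simp_all add: free_proper_action_def)

lemma act_closed: "h \<in> carrier G \<Longrightarrow> q \<in> pts Q \<Longrightarrow> act h q \<in> pts Q"
  using group_action.element_image[OF act] by blast

lemma act_one: "q \<in> pts Q \<Longrightarrow> act \<one>\<^bsub>G\<^esub> q = q"
  using group_action.id_eq_one[OF act] by (metis restrict_apply')

lemma orbit_act:
  assumes h: "h \<in> carrier G" and q: "q \<in> pts Q"
  shows "orbit G act (act h q) = orbit G act q"
proof -
  have hq: "act h q \<in> pts Q" "act h q \<in> orbit G act q"
    using act_closed[OF h q] h by (auto simp: orbit_def)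
  have sub: "orbit G act r \<subseteq> pts Q" if "r \<in> pts Q" for r
    using act_closed that by (auto simp: orbit_def)
  show ?thesis
  proof
    show "orbit G act (act h q) \<subseteq> orbit G act q"
      using group_action.orbit_trans[OF act q hq(1)] hq sub[OF hq(1)] by blast
    show "orbit G act q \<subseteq> orbit G act (act h q)"
      using group_action.orbit_trans[OF act hq(1) q] group_action.orbit_sym[OF act q hq] sub[OF q]
      by blast
  qed
qed

lemma smooth_map_act_point:
  assumes "q \<in> pts Q"
  shows "smooth_map GM (carrier G) Q (\<lambda>h. act h q)"
  using smooth_map_slice_left[OF GC open_carrier Q Q act_smooth assms assms] by simp

lemma smooth_map_act:
  assumes "h \<in> carrier G"
  shows "smooth_map Q (pts Q) Q (act h)"
  using smooth_map_slice_right[OF GM openin_topspace QC Q act_smooth assms] assms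
  by (simp add: pts_GM)

context
  fixes f :: "'q \<Rightarrow> real" and W :: "'q set" and H :: "'g set" and \<psi> :: "'g \<Rightarrow> 'h"
    and N :: "'q set" and \<phi> :: "'q \<Rightarrow> 'e"
  assumes W: "openin (mtop Q) W" and f: "smooth_fun Q W f"
    and H: "(H, \<psi>) \<in> atlas GM" and N: "(N, \<phi>) \<in> atlas Q"
begin

text \<open>The coordinates of those pairs \<open>(h, r)\<close> that the action sends into
  \<open>W\<close>, where \<open>f\<close> is smooth. On this open set \<open>local_rep\<close> is a
  smooth function of group and configuration coordinates jointly, and its derivatives along
  \<open>(u, 0)\<close> and \<open>(0, w)\<close> are those along the two slices.\<close>

definition rep_domain :: "('h \<times> 'e) set" where
  "rep_domain = map_prod \<psi> \<phi> ` ((H \<times> N) \<inter> ((carrier G \<times> pts Q) \<inter> (\<lambda>(h, r). act h r) -` W))"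

definition local_rep :: "'h \<times> 'e \<Rightarrow> real" where
  "local_rep = f \<circ> (\<lambda>(h, r). act h r) \<circ> inv_into (H \<times> N) (map_prod \<psi> \<phi>)"

lemma H_carrier: "H \<subseteq> carrier G" and N_pts: "N \<subseteq> pts Q"
  using openin_subset[OF open_chartsD(1)[OF GC H]] openin_subset[OF open_chartsD(1)[OF QC N]]
  by (simp_all add: pts_GM)

lemma prod_open: "openin (mtop (prod_manifold GM Q)) (carrier G \<times> pts Q)"
  using open_carrier by (simp add: prod_manifold_def openin_prod_Times_iff)

lemma prod_chart: "(H \<times> N, map_prod \<psi> \<phi>) \<in> atlas (prod_manifold GM Q)"
  using H N by (auto simp: prod_manifold_def)

lemmas PC = prod_manifold_open_charts[OF GC QC]

lemma open_rep_domain: "open rep_domain"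
  unfolding rep_domain_def
  by (rule open_chartsD(3)[OF PC prod_chart smooth_map_openin[OF prod_open act_smooth W]])

lemma smooth_local_rep: "smooth_on rep_domain local_rep"
proof -
  have "smooth_fun (prod_manifold GM Q) ((carrier G \<times> pts Q) \<inter> (\<lambda>(h, r). act h r) -` W)
      (f \<circ> (\<lambda>(h, r). act h r))"
    by (rule smooth_fun_compose[OF PC prod_open Q act_smooth W f])
  then show ?thesis
    using prod_chart unfolding smooth_fun_def rep_domain_def local_rep_def by fast
qed

lemma local_rep_eq: "h \<in> H \<Longrightarrow> r \<in> N \<Longrightarrow> local_rep (\<psi> h, \<phi> r) = f (act h r)"
proof -
  assume hr: "h \<in> H" "r \<in> N"
  have "inv_into (H \<times> N) (map_prod \<psi> \<phi>) (map_prod \<psi> \<phi> (h, r)) = (h, r)"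
    by (rule inv_into_f_f[OF open_chartsD(2)[OF PC prod_chart]]) (use hr in simp)
  then show ?thesis by (simp add: local_rep_def)
qed

lemma in_rep_domain: "h \<in> H \<Longrightarrow> r \<in> N \<Longrightarrow> act h r \<in> W \<Longrightarrow> (\<psi> h, \<phi> r) \<in> rep_domain"
  using H_carrier N_pts by (force simp: rep_domain_def)

text \<open>The function \<open>g\<close> is left general because both \<open>local_rep\<close> and
  its first directional derivatives are differentiated along slices.\<close>

lemma slice_derivative_left:
  assumes g: "smooth_on rep_domain g" "\<And>h. h \<in> H \<Longrightarrow> act h r \<in> W \<Longrightarrow> k h = g (\<psi> h, \<phi> r)"
    and h: "h \<in> H" and r: "r \<in> N" "act h r \<in> W" and k: "smooth_near GM h k"
  shows "coord_vec GM (H, \<psi>) h u k = frechet_derivative g (at (\<psi> h, \<phi> r)) (u, 0)"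
proof (rule coord_vec_eqI[OF GC H h k])
  have rp: "r \<in> pts Q" using r N_pts by blast
  let ?T = "\<psi> ` (H \<inter> (carrier G \<inter> (\<lambda>h. act h r) -` W))"
  have T: "open ?T"
    by (rule open_chartsD(3)[OF GC H smooth_map_openin[OF open_carrier smooth_map_act_point[OF rp] W]])
  have "((\<lambda>y. (y, \<phi> r)) has_derivative (\<lambda>u. (u, 0))) (at (\<psi> h))"
    by (auto intro!: derivative_eq_intros)
  from has_derivative_compose[OF this smooth_on_has_derivative[OF g(1) in_rep_domain[OF h r]]]
  have "((\<lambda>y. g (y, \<phi> r)) has_derivative
      (\<lambda>u. frechet_derivative g (at (\<psi> h, \<phi> r)) (u, 0))) (at (\<psi> h))" .
  then show "(k \<circ> inv_into H \<psi> has_derivative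
      (\<lambda>u. frechet_derivative g (at (\<psi> h, \<phi> r)) (u, 0))) (at (\<psi> h))"
  proof (rule has_derivative_transform_within_open[OF _ T])
    show "\<psi> h \<in> ?T" using h r H_carrier by auto
    fix y assume "y \<in> ?T"
    then obtain h' where "h' \<in> H" "act h' r \<in> W" "y = \<psi> h'" by auto
    then show "g (y, \<phi> r) = (k \<circ> inv_into H \<psi>) y"
      using g(2) open_chartsD(2)[OF GC H] by simp
  qed
qed

lemma slice_derivative_right:
  assumes g: "smooth_on rep_domain g" "\<And>r. r \<in> N \<Longrightarrow> act h r \<in> W \<Longrightarrow> k r = g (\<psi> h, \<phi> r)"
    and h: "h \<in> H" and r: "r \<in> N" "act h r \<in> W" and k: "smooth_near Q r k"
  shows "coord_vec Q (N, \<phi>) r w k = frechet_derivative g (at (\<psi> h, \<phi> r)) (0, w)"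
proof (rule coord_vec_eqI[OF QC N r(1) k])
  have hc: "h \<in> carrier G" using h H_carrier by blast
  let ?T = "\<phi> ` (N \<inter> (pts Q \<inter> act h -` W))"
  have T: "open ?T"
    by (rule open_chartsD(3)[OF QC N smooth_map_openin[OF openin_topspace smooth_map_act[OF hc] W]])
  have "((\<lambda>y. (\<psi> h, y)) has_derivative (\<lambda>u. (0, u))) (at (\<phi> r))"
    by (auto intro!: derivative_eq_intros)
  from has_derivative_compose[OF this smooth_on_has_derivative[OF g(1) in_rep_domain[OF h r]]]
  have "((\<lambda>y. g (\<psi> h, y)) has_derivative
      (\<lambda>u. frechet_derivative g (at (\<psi> h, \<phi> r)) (0, u))) (at (\<phi> r))" .
  then show "(k \<circ> inv_into N \<phi> has_derivative
      (\<lambda>u. frechet_derivative g (at (\<psi> h, \<phi> r)) (0, u))) (at (\<phi> r))"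
  proof (rule has_derivative_transform_within_open[OF _ T])
    show "\<phi> r \<in> ?T" using h r N_pts by auto
    fix y assume "y \<in> ?T"
    then obtain r' where "r' \<in> N" "act h r' \<in> W" "y = \<phi> r'" by auto
    then show "g (\<psi> h, y) = (k \<circ> inv_into N \<phi>) y"
      using g(2) open_chartsD(2)[OF QC N] by simp
  qed
qed

lemma generator_local_rep:
  assumes one: "\<one>\<^bsub>G\<^esub> \<in> H" and r: "r \<in> N" "r \<in> W"
  shows "infinitesimal_generator G Q act (coord_vec GM (H, \<psi>) \<one>\<^bsub>G\<^esub> u) r f
    = frechet_derivative local_rep (at (\<psi> \<one>\<^bsub>G\<^esub>, \<phi> r)) (u, 0)"
proof -
  have rp: "r \<in> pts Q" using r N_pts by blast
  have near: "smooth_near Q (act \<one>\<^bsub>G\<^esub> r) f"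
    using smooth_nearI[OF W r(2) f] act_one[OF rp] by simp
  then have "smooth_near GM \<one>\<^bsub>G\<^esub> (f \<circ> (\<lambda>h. act h r))"
    by (rule smooth_near_compose[OF GC open_carrier Q smooth_map_act_point[OF rp] one_carrier])
  then show ?thesis
    using near one r act_one[OF rp] local_rep_eq
    by (simp add: infinitesimal_generator_def tangent_map_def
        slice_derivative_left[OF smooth_local_rep _ one])
qed

end

lemma generator_tangent:
  assumes "\<xi> \<in> tangent_space GM \<one>\<^bsub>G\<^esub>" "q \<in> pts Q"
  shows "infinitesimal_generator G Q act \<xi> q \<in> tangent_space Q q"
  using tangent_map_in_tangent_space[OF GC open_carrier Q smooth_map_act_point[OF assms(2)]
      one_carrier assms(1)] act_one[OF assms(2)] assms(2)
  by (simp add: infinitesimal_generator_def)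

text \<open>The derivative at the identity is a directional derivative of \<open>local_rep\<close>
  at a point depending affinely on the coordinates of \<open>q\<close>. Smoothness in
  \<open>q\<close> thus comes from joint smoothness of the action.\<close>

lemma generator_vector_field:
  assumes \<xi>: "\<xi> \<in> tangent_space GM \<one>\<^bsub>G\<^esub>" and "W \<subseteq> pts Q"
  shows "vector_field Q W (infinitesimal_generator G Q act \<xi>)"
  unfolding vector_field_def
proof (intro conjI ballI allI impI)
  fix q assume "q \<in> W"
  then show "infinitesimal_generator G Q act \<xi> q \<in> tangent_space Q q"
    using generator_tangent[OF \<xi>] assms(2) by blast
next
  fix W' f assume "openin (mtop Q) W' \<and> W' \<subseteq> W \<and> smooth_fun Q W' f"
  then have W': "openin (mtop Q) W'" and f: "smooth_fun Q W' f" and sub: "W' \<subseteq> W" by auto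
  obtain H \<psi> u where H: "(H, \<psi>) \<in> atlas GM" and one: "\<one>\<^bsub>G\<^esub> \<in> H"
    and u: "\<xi> = coord_vec GM (H, \<psi>) \<one>\<^bsub>G\<^esub> u"
    using \<xi> by (rule tangent_spaceE)
  show "smooth_fun Q W' (\<lambda>q. infinitesimal_generator G Q act \<xi> q f)"
    unfolding smooth_fun_def
  proof safe
    fix N \<phi> assume N: "(N, \<phi>) \<in> atlas Q"
    note c = W' f H N
    let ?S = "\<phi> ` (N \<inter> W')"
    have S: "open ?S" by (rule open_chartsD(3)[OF QC N W'])
    let ?D = "\<lambda>z. frechet_derivative (local_rep f H \<psi> N \<phi>) (at z) (u, 0)"
    have "smooth_on (rep_domain W' H \<psi> N \<phi>) ?D"
      by (rule smooth_on_frechet_derivative[OF smooth_local_rep[OF c]])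
    moreover have "(\<lambda>z. (\<psi> \<one>\<^bsub>G\<^esub>, 0) + (0, z)) ` ?S \<subseteq> rep_domain W' H \<psi> N \<phi>"
    proof (rule image_subsetI)
      fix z assume "z \<in> ?S"
      then obtain r where r: "r \<in> N" "r \<in> W'" "z = \<phi> r" by auto
      then have "act \<one>\<^bsub>G\<^esub> r \<in> W'" using act_one sub assms(2) by auto
      from in_rep_domain[OF c one r(1) this]
      show "(\<psi> \<one>\<^bsub>G\<^esub>, 0) + (0, z) \<in> rep_domain W' H \<psi> N \<phi>" by (simp add: r)
    qed
    moreover have "bounded_linear (\<lambda>z::'e. (0::'h, z))"
      by (intro bounded_linear_Pair bounded_linear_ident bounded_linear_zero)
    ultimately have "smooth_on ?S (\<lambda>z. ?D ((\<psi> \<one>\<^bsub>G\<^esub>, 0) + (0, z)))"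
      using smooth_on_compose[OF S _ smooth_on_affine[OF S]] by blast
    then show "smooth_on ?S ((\<lambda>q. infinitesimal_generator G Q act \<xi> q f) \<circ> inv_into N \<phi>)"
    proof (rule smooth_on_cong[OF S, rotated])
      fix z assume "z \<in> ?S"
      then obtain r where r: "r \<in> N" "r \<in> W'" "z = \<phi> r" by auto
      then show "?D ((\<psi> \<one>\<^bsub>G\<^esub>, 0) + (0, z))
          = ((\<lambda>q. infinitesimal_generator G Q act \<xi> q f) \<circ> inv_into N \<phi>) z"
        using open_chartsD(2)[OF QC N] generator_local_rep[OF c one r(1,2)] by (simp add: u)
    qed
  qed
qed

text \<open>The generator differentiates along the orbit, on which \<open>f\<close> is constant. No
  smoothness of \<open>f\<close> is involved, since \<open>tangent_map\<close> yields 0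
  otherwise.\<close>

lemma generator_eq_0:
  assumes \<xi>: "\<xi> \<in> tangent_space GM \<one>\<^bsub>G\<^esub>" and f: "\<And>h. h \<in> carrier G \<Longrightarrow> f (act h q) = f q"
  shows "infinitesimal_generator G Q act \<xi> q f = 0"
proof -
  have "\<xi> (f \<circ> (\<lambda>h. act h q)) = \<xi> (\<lambda>h. f q)"
    by (rule tangent_cong[OF GC \<xi> open_carrier one_carrier]) (simp add: f)
  then show ?thesis
    by (simp add: infinitesimal_generator_def tangent_map_def tangent_const[OF GC \<xi>])
qed

text \<open>In charts both iterated derivatives are mixed partial derivatives of
  \<open>(h, r) \<mapsto> f (h \<cdot> r)\<close>.\<close>

lemma generator_commutes_invariant:
  assumes \<xi>: "\<xi> \<in> tangent_space GM \<one>\<^bsub>G\<^esub>"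
    and W: "openin (mtop Q) W" and X: "vector_field Q W X" and q: "q \<in> W"
    and inv: "\<And>h. h \<in> carrier G \<Longrightarrow> X (act h q) = tangent_map Q (act h) q (X q)"
  shows "lie_bracket Q (infinitesimal_generator G Q act \<xi>) X q = (\<lambda>f. 0)"
proof
  fix f
  let ?V = "infinitesimal_generator G Q act \<xi>"
  have qp: "q \<in> pts Q" using q openin_subset[OF W] by blast
  show "lie_bracket Q ?V X q f = 0"
  proof (cases "smooth_near Q q f")
    case True
    obtain W' where W': "openin (mtop Q) W'" "q \<in> W'" "smooth_fun Q W' f"
      using True unfolding smooth_near_def by blast
    obtain H \<psi> u where H: "(H, \<psi>) \<in> atlas GM" and one: "\<one>\<^bsub>G\<^esub> \<in> H"
      and u: "\<xi> = coord_vec GM (H, \<psi>) \<one>\<^bsub>G\<^esub> u"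
      using \<xi> by (rule tangent_spaceE)
    have "X q \<in> tangent_space Q q" using X q by (simp add: vector_field_def)
    then obtain N \<phi> w where N: "(N, \<phi>) \<in> atlas Q" and qN: "q \<in> N"
      and w: "X q = coord_vec Q (N, \<phi>) q w"
      by (rule tangent_spaceE)
    note c = W'(1,3) H N
    let ?L = "local_rep f H \<psi> N \<phi>"
    have q1: "act \<one>\<^bsub>G\<^esub> q \<in> W'" using act_one[OF qp] W'(2) by simp
    \<comment> \<open>Here the group derivative at the identity is taken first, for every
      \<open>r\<close>, and then differentiated in the configuration slot.\<close>
    have XV: "X q (\<lambda>r. ?V r f) =
        frechet_derivative (\<lambda>z. frechet_derivative ?L (at z) (u, 0)) (at (\<psi> \<one>\<^bsub>G\<^esub>, \<phi> q)) (0, w)"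
      unfolding w
    proof (rule slice_derivative_right[OF c smooth_on_frechet_derivative[OF smooth_local_rep[OF c]] _
          one qN q1])
      fix r assume r: "r \<in> N" "act \<one>\<^bsub>G\<^esub> r \<in> W'"
      then have "r \<in> W'" using act_one N_pts[OF c] by auto
      then show "?V r f = frechet_derivative ?L (at (\<psi> \<one>\<^bsub>G\<^esub>, \<phi> r)) (u, 0)"
        using generator_local_rep[OF c one r(1)] by (simp add: u)
    next
      show "smooth_near Q q (\<lambda>r. ?V r f)"
        by (rule vector_field_smooth_near[OF openin_topspace generator_vector_field[OF \<xi> order_refl]
              qp True])
    qed
    have near: "smooth_near Q (act \<one>\<^bsub>G\<^esub> q) (\<lambda>r. X r f)"
      using vector_field_smooth_near[OF W X q True] act_one[OF qp] by simp
    have "?V q (\<lambda>r. X r f) = \<xi> (\<lambda>h. X (act h q) f)"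
      using near by (simp add: infinitesimal_generator_def tangent_map_def comp_def)
    also have "\<dots> =
        frechet_derivative (\<lambda>z. frechet_derivative ?L (at z) (0, w)) (at (\<psi> \<one>\<^bsub>G\<^esub>, \<phi> q)) (u, 0)"
      unfolding u
    proof (rule slice_derivative_left[OF c smooth_on_frechet_derivative[OF smooth_local_rep[OF c]] _
          one qN q1])
      fix h assume h: "h \<in> H" "act h q \<in> W'"
      have hc: "h \<in> carrier G" using h H_carrier[OF c] by blast
      have fn: "smooth_near Q (act h q) f" by (rule smooth_nearI[OF W'(1) h(2) W'(3)])
      \<comment> \<open>Invariance moves the evaluation from \<open>act h q\<close> back to
        \<open>q\<close>, with \<open>f\<close> translated instead. This makes the value a
        configuration derivative of \<open>local_rep\<close> with \<open>h\<close> as parameter,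
        ready to be differentiated in the group slot.\<close>
      have "X (act h q) f = X q (f \<circ> act h)"
        using fn by (simp add: inv[OF hc] tangent_map_def)
      also have "\<dots> = frechet_derivative ?L (at (\<psi> h, \<phi> q)) (0, w)"
        unfolding w
        by (rule slice_derivative_right[OF c smooth_local_rep[OF c] _ h(1) qN h(2)
              smooth_near_compose[OF QC openin_topspace Q smooth_map_act[OF hc] qp fn]])
          (simp add: local_rep_eq[OF c h(1)])
      finally show "X (act h q) f = frechet_derivative ?L (at (\<psi> h, \<phi> q)) (0, w)" .
    next
      show "smooth_near GM \<one>\<^bsub>G\<^esub> (\<lambda>h. X (act h q) f)"
        using smooth_near_compose[OF GC open_carrier Q smooth_map_act_point[OF qp] one_carrier near]
        by (simp add: comp_def)
    qed
    finally show ?thesis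
      using XV frechet_derivative_commute[OF open_rep_domain[OF c] in_rep_domain[OF c one qN q1] smooth_local_rep[OF c]]
      True by (simp add: lie_bracket_def)
  qed (simp add: lie_bracket_def)
qed

end

section \<open>Horizontal lifts\<close>

text \<open>A horizontal vector is determined by its projection. The translate of \<open>X q\<close>
  is horizontal because the connection is invariant, and it has the same projection as
  \<open>X (act h q)\<close> because the bundle projection is constant on orbits.\<close>

lemma horizontal_lift_invariant:
  fixes Q :: "('q, 'e::euclidean_space) manifold" and X :: "'q vfield"
  assumes action: "lie_group_action G GM Q act" and B: "smooth_manifold B"
    and conn: "principal_connection G Q act B D"
    and proj: "smooth_map Q (pts Q) B (orbit G act)"
    and lift: "horizontal_lift Q D B (orbit G act) W Z X"
    and inv: "\<And>h q. h \<in> carrier G \<Longrightarrow> q \<in> W \<Longrightarrow> act h q \<in> W" and W: "W \<subseteq> pts Q"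
    and h: "h \<in> carrier G" and q: "q \<in> W"
  shows "X (act h q) = tangent_map Q (act h) q (X q)"
proof -
  interpret lie_group_action G GM Q act by fact
  let ?\<pi> = "orbit G act" and ?r = "act h q" and ?Y = "tangent_map Q (act h) q (X q)"
  have qp: "q \<in> pts Q" and r: "?r \<in> W" and rp: "?r \<in> pts Q"
    using q W inv[OF h q] by auto
  have Xq: "X q \<in> D q" "tangent_map B ?\<pi> q (X q) = Z (?\<pi> q)"
    and Xr: "X ?r \<in> D ?r" "tangent_map B ?\<pi> ?r (X ?r) = Z (?\<pi> ?r)"
    using lift q r by (auto simp: horizontal_lift_def)
  have D: "D p \<subseteq> tangent_space Q p" if "p \<in> pts Q" for p
    using conn that by (simp add: principal_connection_def)
  have "tangent_map Q (act h) q ` D q = D ?r"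
    using conn h qp by (simp add: principal_connection_def)
  then have Y: "?Y \<in> D ?r" using Xq(1) by blast
  have t: "X q \<in> tangent_space Q q" "X ?r \<in> tangent_space Q ?r" "?Y \<in> tangent_space Q ?r"
    using D qp rp Xq(1) Xr(1) Y by auto
  have TY: "tangent_map B ?\<pi> ?r ?Y = tangent_map B ?\<pi> ?r (X ?r)"
  proof
    fix f
    show "tangent_map B ?\<pi> ?r ?Y f = tangent_map B ?\<pi> ?r (X ?r) f"
    proof (cases "smooth_near B (?\<pi> ?r) f")
      case True
      have near: "smooth_near Q ?r (f \<circ> ?\<pi>)"
        by (rule smooth_near_compose[OF QC openin_topspace B proj rp True])
      have "X q (f \<circ> ?\<pi> \<circ> act h) = X q (f \<circ> ?\<pi>)"
        by (rule tangent_cong[OF QC t(1) openin_topspace qp]) (simp add: orbit_act[OF h])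
      then have "tangent_map B ?\<pi> ?r ?Y f = tangent_map B ?\<pi> q (X q) f"
        using True near by (simp add: tangent_map_def orbit_act[OF h qp])
      then show ?thesis using Xq(2) Xr(2) orbit_act[OF h qp] by simp
    qed (simp add: tangent_map_def)
  qed
  define d where "d = (\<lambda>f. 1 * X ?r f + (- 1) * ?Y f)"
  have "d \<in> tangent_space Q ?r"
    unfolding d_def by (rule tangent_space_combination[OF Q t(2,3)])
  moreover have "tangent_map B ?\<pi> ?r d = (\<lambda>f. 0)"
  proof
    show "tangent_map B ?\<pi> ?r d f = 0" for f
      using fun_cong[OF TY, of f] by (simp add: tangent_map_def d_def split: if_splits)
  qed
  ultimately have d: "d \<in> vertical_space Q B ?\<pi> ?r" by (simp add: vertical_space_def)
  have zero: "(\<lambda>f. 0) \<in> vertical_space Q B ?\<pi> ?r"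
    using tangent_space_combination[OF Q t(2,2), of 0 0]
    by (auto simp: vertical_space_def tangent_map_def)
  have ex: "\<exists>!z. z \<in> D ?r \<times> vertical_space Q B ?\<pi> ?r \<and> X ?r = (\<lambda>f. fst z f + snd z f)"
    using conn rp t(2) by (simp add: principal_connection_def)
  \<comment> \<open>Two splittings of \<open>X ?r\<close> into horizontal and vertical part: the
    trivial one, and the translate with the difference \<open>d\<close> as vertical part. Uniqueness
    identifies them.\<close>
  have 1: "(X ?r, \<lambda>f. 0) \<in> D ?r \<times> vertical_space Q B ?\<pi> ?r \<and>
      X ?r = (\<lambda>f. fst (X ?r, \<lambda>f. 0) f + snd (X ?r, \<lambda>f. 0) f)"
    using Xr(1) zero by simp
  have 2: "(?Y, d) \<in> D ?r \<times> vertical_space Q B ?\<pi> ?r \<and>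
      X ?r = (\<lambda>f. fst (?Y, d) f + snd (?Y, d) f)"
    using Y d by (simp add: d_def)
  have unique: "a = b" if "\<exists>!z. P z" "P a" "P b" for P :: "'q tvec \<times> 'q tvec \<Rightarrow> bool" and a b
    using that by blast
  have "(X ?r, \<lambda>f. 0) = (?Y, d)" by (rule unique[OF ex 1 2])
  then show ?thesis by simp
qed

section \<open>Independence of the lifts and their Gram matrix\<close>

lemma coordinate_function:
  fixes x :: "'p \<Rightarrow> real^'m"
  assumes M: "smooth_manifold M" and c: "(U, x) \<in> atlas M" and p: "p \<in> U"
  shows "smooth_near M p (\<lambda>r. x r $ b)" "coord_vec M (U, x) p u (\<lambda>r. x r $ b) = u $ b"
proof -
  note MC = smooth_manifold_open_charts[OF M]
  note U = open_chartsD[OF MC c]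
  have "smooth_fun M U (\<lambda>r. x r $ b)"
    unfolding smooth_fun_def
  proof safe
    fix V \<psi> assume V: "(V, \<psi>) \<in> atlas M"
    have S: "open (\<psi> ` (V \<inter> U))" by (rule open_chartsD(3)[OF MC V U(1)])
    have "smooth_on (\<psi> ` (V \<inter> U)) (x \<circ> inv_into V \<psi>)"
      using M V c unfolding smooth_manifold_def by blast
    then have "smooth_on (\<psi> ` (V \<inter> U)) (\<lambda>z. (x \<circ> inv_into V \<psi>) z $ b)"
      unfolding smooth_on_def using diff_class_on_linear[OF S bounded_linear_vec_nth] by blast
    then show "smooth_on (\<psi> ` (V \<inter> U)) ((\<lambda>r. x r $ b) \<circ> inv_into V \<psi>)"
      by (simp add: comp_def)
  qed
  then show near: "smooth_near M p (\<lambda>r. x r $ b)" by (rule smooth_nearI[OF U(1) p])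
  have "((\<lambda>z. z $ b) has_derivative (\<lambda>u. u $ b)) (at (x p))"
    by (rule bounded_linear_imp_has_derivative[OF bounded_linear_vec_nth])
  then have "((\<lambda>r. x r $ b) \<circ> inv_into U x has_derivative (\<lambda>u. u $ b)) (at (x p))"
    by (rule has_derivative_transform_within_open[OF _ U(3)[OF U(1)]]) (use U(2) p in auto)
  from coord_vec_eqI[OF MC c p near this]
  show "coord_vec M (U, x) p u (\<lambda>r. x r $ b) = u $ b" .
qed

text \<open>Pulled-back coordinates of the base serve as test functions: on them the lifts take the
  values of the Kronecker delta, so each one extracts a coefficient.\<close>

lemma horizontal_lift_independent:
  fixes x :: "'b \<Rightarrow> real^'m"
  assumes Q: "smooth_manifold Q" and B: "smooth_manifold B" and proj: "smooth_map Q (pts Q) B \<pi>"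
    and chart: "(U, x) \<in> atlas B" and q: "q \<in> pts Q" "q \<in> W" "\<pi> q \<in> U"
    and lift: "\<And>a. horizontal_lift Q D B \<pi> W (\<lambda>b. coord_vec B (U, x) b (axis a 1)) (X a)"
    and zero: "lincomb UNIV c (\<lambda>a. X a q) = (\<lambda>f. 0)"
  shows "c b = 0"
proof -
  note QC = smooth_manifold_open_charts[OF Q]
  have "X a q ((\<lambda>p. x p $ b) \<circ> \<pi>) = axis a 1 $ b" for a
  proof -
    have "tangent_map B \<pi> q (X a q) = coord_vec B (U, x) (\<pi> q) (axis a 1)"
      using lift q(2) by (simp add: horizontal_lift_def)
    from fun_cong[OF this, of "\<lambda>p. x p $ b"] show ?thesis
      using coordinate_function[OF B chart q(3), where b = b] by (simp add: tangent_map_def)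
  qed
  then show ?thesis
    using fun_cong[OF zero, of "(\<lambda>p. x p $ b) \<circ> \<pi>"]
    by (simp add: lincomb_def axis_def if_distrib[of "\<lambda>t. _ * t"] cong: if_cong)
qed

text \<open>A vector in the kernel is the coefficient vector of a combination orthogonal to every
  \<open>X a\<close>, hence to itself, hence zero.\<close>

lemma gram_matrix_invertible:
  fixes X :: "'m::finite \<Rightarrow> 'p tvec"
  assumes M: "smooth_manifold M" and g: "riemannian_metric M g" and p: "p \<in> pts M"
    and X: "\<And>a. X a \<in> tangent_space M p"
    and ind: "\<And>c b. lincomb UNIV c X = (\<lambda>f. 0) \<Longrightarrow> c b = 0"
  shows "invertible (\<chi> a b. g p (X a) (X b))"
proof -
  have s: "symmetric_tensor M g" using g by (simp add: riemannian_metric_def)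
  have "c = 0" if c: "(\<chi> a b. g p (X a) (X b)) *v c = 0" for c
  proof -
    let ?N = "lincomb UNIV (\<lambda>a. c $ a) X"
    have N: "?N \<in> tangent_space M p" by (rule tangent_space_lincomb[OF M p X])
    have "g p (X a) ?N = 0" for a
    proof -
      have "g p (X a) ?N = (\<Sum>b\<in>UNIV. c $ b * g p (X b) (X a))"
        using symmetric_tensor_commute[OF s p X N] symmetric_tensor_lincomb[OF M s p X X] by simp
      also have "\<dots> = ((\<chi> a b. g p (X a) (X b)) *v c) $ a"
        by (simp add: matrix_vector_mult_def symmetric_tensor_commute[OF s p X X] mult.commute)
      finally show ?thesis by (simp add: c)
    qed
    then have "g p ?N ?N = 0" by (simp add: symmetric_tensor_lincomb[OF M s p X N])
    then have "?N = (\<lambda>f. 0)"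
      using g p N unfolding riemannian_metric_def by (metis less_irrefl)
    then show "c = 0" using ind by (simp add: vec_eq_iff)
  qed
  then show ?thesis
    by (simp add: invertible_left_inverse matrix_left_invertible_ker)
qed

section \<open>Tensors, connections and frames\<close>

lemma symmetric_tensor_smooth:
  assumes "symmetric_tensor M g" "openin (mtop M) W" "vector_field M W X" "vector_field M W Y"
  shows "smooth_fun M W (\<lambda>p. g p (X p) (Y p))"
  using assms unfolding symmetric_tensor_def by simp

lemma levi_civita_tangent:
  assumes "levi_civita_connection M g nabla" "p \<in> pts M" "v \<in> tangent_space M p"
    and "vector_field_near M p Y"
  shows "nabla p v Y \<in> tangent_space M p"
  using assms unfolding levi_civita_connection_def affine_connection_def by simp

lemma levi_civita_torsion:
  assumes "levi_civita_connection M g nabla" "p \<in> pts M"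
    and "vector_field_near M p X" "vector_field_near M p Y"
  shows "nabla p (X p) Y f - nabla p (Y p) X f = lie_bracket M X Y p f"
proof -
  have "(\<lambda>f. nabla p (X p) Y f - nabla p (Y p) X f) = lie_bracket M X Y p"
    using assms unfolding levi_civita_connection_def by simp
  then show ?thesis by (rule fun_cong)
qed

lemma levi_civita_metric:
  assumes "levi_civita_connection M g nabla" "p \<in> pts M" "v \<in> tangent_space M p"
    and "vector_field_near M p X" "vector_field_near M p Y"
  shows "v (\<lambda>r. g r (X r) (Y r)) = g p (nabla p v X) (Y p) + g p (X p) (nabla p v Y)"
  using assms unfolding levi_civita_connection_def by simp

lemma lincomb_sum_type:
  "lincomb (UNIV :: ('m::finite + 'k::finite) set) c Y
   = (\<lambda>f. (\<Sum>a\<in>UNIV. c (Inl a) * Y (Inl a) f) + (\<Sum>k\<in>UNIV. c (Inr k) * Y (Inr k) f))"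
  unfolding lincomb_def UNIV_Plus_UNIV[symmetric] by (subst sum.Plus) simp_all

text \<open>Replaces a comparison of coefficients, so that independence of the \<open>Y k\<close> is not required.\<close>

lemma orthogonal_combination_eq_0:
  fixes X :: "'m::finite \<Rightarrow> 'p tvec" and Y :: "'k::finite \<Rightarrow> 'p tvec"
  assumes M: "smooth_manifold M" and g: "riemannian_metric M g" and p: "p \<in> pts M"
    and X: "\<And>a. X a \<in> tangent_space M p" and Y: "\<And>k. Y k \<in> tangent_space M p"
    and orth: "\<And>a k. g p (X a) (Y k) = 0"
    and eq: "lincomb UNIV \<rho> Y = lincomb UNIV \<mu> X"
  shows "lincomb UNIV \<rho> Y = (\<lambda>f. 0)"
proof -
  have s: "symmetric_tensor M g" using g by (simp add: riemannian_metric_def)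
  let ?N = "lincomb UNIV \<rho> Y"
  have N: "?N \<in> tangent_space M p" by (rule tangent_space_lincomb[OF M p Y])
  have "g p (X a) ?N = 0" for a
    using symmetric_tensor_commute[OF s p X N] symmetric_tensor_lincomb[OF M s p Y X]
      symmetric_tensor_commute[OF s p Y X] by (simp add: orth)
  then have "g p (lincomb UNIV \<mu> X) ?N = 0" by (simp add: symmetric_tensor_lincomb[OF M s p X N])
  then have "g p ?N ?N = 0" by (simp add: eq)
  then show ?thesis using g p N unfolding riemannian_metric_def by (metis less_irrefl)
qed

lemma linear_form_has_derivative:
  fixes c :: "'m::finite \<Rightarrow> real"
  shows "((\<lambda>w. \<Sum>b\<in>UNIV. c b * w $ b) has_derivative (\<lambda>w. \<Sum>b\<in>UNIV. c b * w $ b)) (at (v :: real^'m))"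
  by (intro bounded_linear_imp_has_derivative bounded_linear_sum bounded_linear_const_mult
      bounded_linear_vec_nth)

text \<open>Evaluates the sum over \<open>d\<close> in (A'), with \<open>Gab q $ b $ d\<close> as
  \<open>h d\<close>.\<close>

lemma sum_delta_difference:
  fixes h :: "'m::finite \<Rightarrow> real"
  shows "(\<Sum>d\<in>UNIV. h d * ((if d = a then 1 else 0) * s - (if d = c then 1 else 0) * t) * y * z)
    = (h a * s - h c * t) * y * z"
proof -
  have "h d * ((if d = a then 1 else 0) * s - (if d = c then 1 else 0) * t) * y * z
      = (if d = a then h d * s * y * z else 0) - (if d = c then h d * t * y * z else 0)" for d
    by (cases "d = a"; cases "d = c") (simp_all add: algebra_simps)
  then have "(\<Sum>d\<in>UNIV. h d * ((if d = a then 1 else 0) * s - (if d = c then 1 else 0) * t) * y * z)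
      = (\<Sum>d\<in>UNIV. if d = a then h d * s * y * z else 0) - (\<Sum>d\<in>UNIV. if d = c then h d * t * y * z else 0)"
    by (simp only: sum_subtractf)
  then show ?thesis by (simp add: algebra_simps)
qed

text \<open>A function linear in the velocities is its own fibre derivative, so the field takes it
  to a quadratic form in \<open>v\<close>. Only the contribution of \<open>\<eta>\<close> is written
  out, in the form in which the multiplier will appear.\<close>

lemma nonholonomic_field_add_linear:
  fixes X :: "'m::finite \<Rightarrow> 'q vfield"
  assumes M: "open_charts M" and X: "\<And>a. X a q \<in> tangent_space M q"
    and \<theta>: "\<And>a. smooth_near M q (\<theta> a)" and \<eta>: "\<And>a. smooth_near M q (\<eta> a)"
  shows "nonholonomic_field X \<Gamma> (\<lambda>r w. \<Sum>a\<in>UNIV. (\<theta> a r + \<eta> a r) * w $ a) q v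
    = nonholonomic_field X \<Gamma> (\<lambda>r w. \<Sum>a\<in>UNIV. \<theta> a r * w $ a) q v
      + ((\<Sum>a\<in>UNIV. \<Sum>b\<in>UNIV. X a q (\<eta> b) * v $ a * v $ b)
         - (\<Sum>d\<in>UNIV. \<eta> d q * (\<Sum>a\<in>UNIV. \<Sum>b\<in>UNIV. \<Gamma> d a b q * v $ a * v $ b)))"
proof -
  have lin: "nonholonomic_field X \<Gamma> (\<lambda>r w. \<Sum>a\<in>UNIV. h a r * w $ a) q v
    = (\<Sum>a\<in>UNIV. \<Sum>b\<in>UNIV. X a q (h b) * v $ a * v $ b)
      - (\<Sum>d\<in>UNIV. h d q * (\<Sum>a\<in>UNIV. \<Sum>b\<in>UNIV. \<Gamma> d a b q * v $ a * v $ b))"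
    if h: "\<And>a. smooth_near M q (h a)" for h
  proof -
    have "smooth_near M q (\<lambda>r. h b r * v $ b)" for b
      by (rule smooth_near_mult[OF M h smooth_near_const[OF tangent_space_pts[OF M X]]])
    from tangent_sum[OF M X this]
    have "X a q (\<lambda>r. \<Sum>b\<in>UNIV. h b r * v $ b) = (\<Sum>b\<in>UNIV. X a q (h b) * v $ b)" for a
      using tangent_cmult[OF M X h] by (simp add: mult.commute)
    moreover have "frechet_derivative (\<lambda>w. \<Sum>b\<in>UNIV. h b q * w $ b) (at v)
        = (\<lambda>w. \<Sum>b\<in>UNIV. h b q * w $ b)"
      by (rule frechet_derivative_at[symmetric]) (rule linear_form_has_derivative)
    ultimately show ?thesis
      by (simp add: nonholonomic_field_def sum_distrib_left sum_negf mult_ac)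
  qed
  have add: "X a q (\<lambda>r. \<theta> b r + \<eta> b r) = X a q (\<theta> b) + X a q (\<eta> b)" for a b
    by (rule tangent_add[OF M X \<theta> \<eta>])
  have sum: "smooth_near M q (\<lambda>r. \<theta> a r + \<eta> a r)" for a
    by (rule smooth_near_add[OF M \<theta> \<eta>])
  show ?thesis
    unfolding lin[of \<theta>, OF \<theta>] lin[of "\<lambda>a r. \<theta> a r + \<eta> a r", OF sum] add
    by (simp add: distrib_right sum.distrib)
qed

lemma sum_antisymmetric_eq_0:
  fixes S :: "'m::finite \<Rightarrow> 'm \<Rightarrow> real"
  assumes "\<And>a b. S a b + S b a = 0"
  shows "(\<Sum>a\<in>UNIV. \<Sum>b\<in>UNIV. S a b * y a * y b) = 0"
proof -
  have "(\<Sum>a\<in>UNIV. \<Sum>b\<in>UNIV. S a b * y a * y b) = (\<Sum>a\<in>UNIV. \<Sum>b\<in>UNIV. S b a * y a * y b)"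
    by (subst sum.swap) (simp add: mult_ac)
  also have "\<dots> = (\<Sum>a\<in>UNIV. \<Sum>b\<in>UNIV. - (S a b * y a * y b))"
  proof (intro sum.cong refl)
    fix a b
    have "S b a = - S a b" using assms[of a b] by simp
    then show "S b a * y a * y b = - (S a b * y a * y b)" by simp
  qed
  finally show ?thesis by (simp add: sum_negf)
qed

section \<open>The equivalence\<close>

theorem proposition2:
  fixes G :: "'g monoid" and GM :: "('g, real^'k) manifold"
    and Q :: "('q, real^'n) manifold" and B :: "('q set, real^'m) manifold"
    and act :: "'g \<Rightarrow> 'q \<Rightarrow> 'q" and \<pi> :: "'q \<Rightarrow> 'q set"
    and g gbar :: "'q tensor2" and D :: "'q \<Rightarrow> 'q tvec set"
    and nabla :: "'q \<Rightarrow> 'q tvec \<Rightarrow> 'q vfield \<Rightarrow> 'q tvec"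
    and \<xi> :: "'k \<Rightarrow> 'g tvec"
    and U :: "'q set set" and x :: "'q set \<Rightarrow> real^'m" and W :: "'q set"
    and X :: "'m \<Rightarrow> 'q vfield" and V Xv :: "'k \<Rightarrow> 'q vfield" and E :: "'m + 'k \<Rightarrow> 'q vfield"
    and Gab :: "'q \<Rightarrow> real^'m^'m" and Gai :: "'m \<Rightarrow> 'k \<Rightarrow> 'q \<Rightarrow> real"
    and K :: "'m \<Rightarrow> 'k \<Rightarrow> 'q \<Rightarrow> real" and gij :: "'k \<Rightarrow> 'k \<Rightarrow> 'q \<Rightarrow> real"
    and gbarai :: "'m \<Rightarrow> 'k \<Rightarrow> 'q \<Rightarrow> real"
    and R :: "'m + 'k \<Rightarrow> 'm + 'k \<Rightarrow> 'm + 'k \<Rightarrow> 'q \<Rightarrow> real"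
    and \<Gamma> :: "'m + 'k \<Rightarrow> 'm \<Rightarrow> 'm \<Rightarrow> 'q \<Rightarrow> real"
    and \<Gamma>nh :: "('q \<Rightarrow> real^'m \<Rightarrow> real) \<Rightarrow> 'q \<Rightarrow> real^'m \<Rightarrow> real"
    and f :: "'q set \<Rightarrow> real" and F :: "'q \<Rightarrow> real"
    and \<theta> lam C :: "'k \<Rightarrow> 'q \<Rightarrow> real^'m \<Rightarrow> real"
  assumes dim: "CARD('n) = CARD('m) + CARD('k)"
    and chaplygin: "chaplygin_system G GM Q act B g D"
    and levi_civita: "levi_civita_connection Q g nabla"
    and modification: "preserving_modification Q D g gbar"
    and proj: "\<pi> = orbit G act"
    and chart: "(U, x) \<in> atlas B"
    and domain: "W = {q \<in> pts Q. \<pi> q \<in> U}"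
    and basis: "lie_algebra_basis G GM \<xi>"
    and V: "\<And>i. V i = infinitesimal_generator G Q act (\<xi> i)"
    and X: "\<And>a. horizontal_lift Q D B \<pi> W (\<lambda>b. coord_vec B (U, x) b (axis a 1)) (X a)"
    and Gab: "\<And>q. Gab q = (\<chi> a b. g q (X a q) (X b q))"
    and Gai: "\<And>a i q. Gai a i q = g q (X a q) (V i q)"
    and K: "\<And>b i q. K b i q = - (\<Sum>a\<in>UNIV. matrix_inv (Gab q) $ a $ b * Gai a i q)"
    and Xv: "\<And>i q h. Xv i q h = V i q h + (\<Sum>b\<in>UNIV. K b i q * X b q h)"
    and E: "\<And>a. E (Inl a) = X a" "\<And>i. E (Inr i) = Xv i"
    and gij: "\<And>i j q. gij i j q = g q (Xv i q) (Xv j q)"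
    and gbarai: "\<And>a i q. gbarai a i q = gbar q (X a q) (Xv i q)"
    and R: "\<And>\<alpha> \<beta> q. q \<in> W \<Longrightarrow>
      lie_bracket Q (E \<alpha>) (E \<beta>) q = lincomb UNIV (\<lambda>\<gamma>. R \<gamma> \<alpha> \<beta> q) (\<lambda>\<gamma>. E \<gamma> q)"
    and \<Gamma>: "\<And>a b q. q \<in> W \<Longrightarrow>
      nabla q (X a q) (X b) = lincomb UNIV (\<lambda>\<gamma>. \<Gamma> \<gamma> a b q) (\<lambda>\<gamma>. E \<gamma> q)"
    and \<Gamma>nh: "\<Gamma>nh = nonholonomic_field X (\<lambda>d. \<Gamma> (Inl d))"
    and lam: "\<And>i q v. lam i q v =
      (\<Sum>k\<in>UNIV. \<Sum>a\<in>UNIV. \<Sum>b\<in>UNIV. gij k i q * \<Gamma> (Inr k) a b q * v $ a * v $ b)"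
    and f: "smooth_fun B (pts B) f"
    and F: "F = f \<circ> \<pi>"
    and \<theta>: "\<And>k q v. \<theta> k q v = (\<Sum>a\<in>UNIV. gbarai a k q * v $ a)"
    and C: "\<And>i q v. C i q v = (\<Sum>a\<in>UNIV. (gbarai a i q + Gai a i q) * v $ a)"
    and A': "\<forall>q\<in>W. \<forall>v c.
      (\<Sum>a\<in>UNIV. \<Sum>b\<in>UNIV. \<Sum>d\<in>UNIV. Gab q $ b $ d *
         ((if d = a then 1 else 0) * X c q F - (if d = c then 1 else 0) * X a q F) * v $ a * v $ b)
      + (\<Sum>k\<in>UNIV. \<Sum>a\<in>UNIV. \<theta> k q v * R (Inr k) (Inl a) (Inl c) q * v $ a) = 0"
  shows
    "(\<forall>i. \<forall>q\<in>W. \<forall>v.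
        \<Gamma>nh (\<theta> i) q v + lam i q v
        + (\<Sum>k\<in>UNIV. \<Sum>a\<in>UNIV. \<theta> k q v *
             (R (Inr k) (Inr i) (Inl a) q + (if k = i then 1 else 0) * X a q F) * v $ a)
        - (\<Sum>a\<in>UNIV. \<Sum>b\<in>UNIV. Gab q $ a $ b * Xv i q F * v $ a * v $ b) = 0)
     \<longleftrightarrow>
     (\<forall>i. \<forall>q\<in>W. \<forall>v.
        \<Gamma>nh (C i) q v + \<Gamma>nh (\<lambda>r w. F r) q v * C i q v = 0)"
proof -

  \<comment> \<open>Consequences of the group invariance\<close>
  have Qm: "smooth_manifold Q" and lie: "lie_group G GM" and free_proper: "free_proper_action G GM Q act"
    and principal: "principal_bundle G GM Q act B" and g: "riemannian_metric Q g"
    and conn: "principal_connection G Q act B D"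
    and g_inv: "\<And>h q u v. h \<in> carrier G \<Longrightarrow> q \<in> pts Q \<Longrightarrow> u \<in> tangent_space Q q \<Longrightarrow>
      v \<in> tangent_space Q q \<Longrightarrow>
      g (act h q) (tangent_map Q (act h) q u) (tangent_map Q (act h) q v) = g q u v"
    using chaplygin unfolding chaplygin_system_def by simp_all
  interpret act: lie_group_action G GM Q act
    by unfold_locales fact+
  note QC = act.QC
  have Bm: "smooth_manifold B" and \<pi>: "smooth_map Q (pts Q) B \<pi>"
    using principal by (simp_all add: principal_bundle_def proj)
  have U: "openin (mtop B) U"
    by (rule open_chartsD(1)[OF smooth_manifold_open_charts[OF Bm] chart])
  have "W = pts Q \<inter> \<pi> -` U" using domain by auto
  then have W: "openin (mtop Q) W"
    using smooth_map_openin[OF openin_topspace \<pi> U] by simp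
  have Wp: "W \<subseteq> pts Q" using domain by auto
  \<comment> \<open>The frame domain is a union of orbits, so the lifts can be compared along whole
    orbits.\<close>
  have act_W: "act h q \<in> W" if "h \<in> carrier G" "q \<in> W" for h q
    using that act.act_closed act.orbit_act by (auto simp: domain proj)
  have Xvf: "vector_field Q W (X a)" for a
    using X by (simp add: horizontal_lift_def)
  have Xt: "X a q \<in> tangent_space Q q" if "q \<in> W" for a q
    using Xvf that by (simp add: vector_field_def)
  have \<xi>: "\<xi> i \<in> tangent_space GM \<one>\<^bsub>G\<^esub>" for i
    using basis by (simp add: lie_algebra_basis_def)
  have Vvf: "vector_field Q W (V i)" for i
    unfolding V by (rule act.generator_vector_field[OF \<xi> Wp])
  have Vt: "V i q \<in> tangent_space Q q" if "q \<in> W" for i q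
    using Vvf that by (simp add: vector_field_def)
  have X_inv: "X a (act h q) = tangent_map Q (act h) q (X a q)" if "h \<in> carrier G" "q \<in> W" for a h q
    by (rule horizontal_lift_invariant[OF act.lie_group_action_axioms Bm conn \<pi>[unfolded proj]
          X[unfolded proj] act_W Wp that])
  have V_X: "lie_bracket Q (V i) (X a) q = (\<lambda>f. 0)" if "q \<in> W" for i a q
    unfolding V by (rule act.generator_commutes_invariant[OF \<xi> W Xvf that X_inv[OF _ that]])
  have V_F: "V i q F = 0" if "q \<in> W" for i q
    unfolding V
    by (rule act.generator_eq_0[OF \<xi>]) (use that Wp in \<open>auto simp: F proj act.orbit_act\<close>)
  have V_G: "V i q (\<lambda>r. g r (X a r) (X b r)) = 0" if "q \<in> W" for i a b q
    unfolding V
    by (rule act.generator_eq_0[OF \<xi>]) (use that Wp Xt in \<open>auto simp: X_inv g_inv\<close>)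

  \<comment> \<open>The orthogonal frame\<close>
  have gs: "symmetric_tensor Q g" using g by (simp add: riemannian_metric_def)
  have gbs: "symmetric_tensor Q gbar"
    using modification by (simp add: preserving_modification_def)
  have G_sym: "Gab q $ a $ b = Gab q $ b $ a" if "q \<in> W" for q a b
    using symmetric_tensor_commute[OF gs _ Xt Xt] that Wp by (auto simp: Gab)
  have G_invertible: "invertible (Gab q)" if q: "q \<in> W" for q
  proof -
    have qp: "q \<in> pts Q" and qU: "\<pi> q \<in> U" using q domain by auto
    show ?thesis
      unfolding Gab
      by (rule gram_matrix_invertible[OF Qm g qp Xt[OF q]])
        (rule horizontal_lift_independent[OF Qm Bm \<pi> chart qp q qU X])
  qed
  have K_smooth: "smooth_fun Q W (K b i)" for b i
  proof -
    have "smooth_fun Q W (\<lambda>q. Gab q $ a $ b)" for a b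
      using symmetric_tensor_smooth[OF gs W Xvf Xvf] by (simp add: Gab)
    then have "smooth_fun Q W (\<lambda>q. matrix_inv (Gab q) $ a $ b)" for a b
      by (intro smooth_fun_matrix_inv[OF QC W _ G_invertible])
    moreover have "smooth_fun Q W (Gai a i)" for a
      using symmetric_tensor_smooth[OF gs W Xvf Vvf, of a i] by (simp add: Gai[abs_def])
    ultimately have "smooth_fun Q W (\<lambda>q. (- 1) * (\<Sum>a\<in>UNIV. matrix_inv (Gab q) $ a $ b * Gai a i q))"
      by (intro smooth_fun_mult[OF QC W] smooth_fun_const smooth_fun_sum[OF QC W])
    then show ?thesis by (simp add: K[abs_def])
  qed
  have Xv_eq: "Xv i = (\<lambda>q h. V i q h + (\<Sum>b\<in>UNIV. K b i q * X b q h))" for i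
    by (intro ext) (rule Xv)
  have Xvvf: "vector_field Q W (Xv i)" for i
    unfolding Xv_eq by (rule vector_field_add_scaled[OF Qm W Vvf Xvf K_smooth])
  have Xvt: "Xv i q \<in> tangent_space Q q" if "q \<in> W" for i q
    using Xvvf that by (simp add: vector_field_def)
  have tensor_Xv: "s q (Xv i q) w = s q (V i q) w + (\<Sum>b\<in>UNIV. K b i q * s q (X b q) w)"
    if s: "symmetric_tensor Q s" and q: "q \<in> W" and w: "w \<in> tangent_space Q q" for s i q w
  proof -
    have qp: "q \<in> pts Q" using q Wp by blast
    let ?N = "lincomb UNIV (\<lambda>b. K b i q) (\<lambda>b. X b q)"
    have N: "?N \<in> tangent_space Q q" by (rule tangent_space_lincomb[OF Qm qp Xt[OF q]])
    have "Xv i q = (\<lambda>f. 1 * V i q f + 1 * ?N f)" by (simp add: Xv_eq lincomb_def)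
    then show ?thesis
      using symmetric_tensor_linear[where a = 1 and b = 1, OF s qp Vt[OF q, of i] N w]
        symmetric_tensor_lincomb[OF Qm s qp Xt[OF q] w] by simp
  qed
  \<comment> \<open>The property for which \<open>K\<close> is chosen: it cancels the inner products
    of \<open>V i\<close> with the distribution. It returns when (A') is contracted with
    \<open>K\<close>.\<close>
  have K_G: "(\<Sum>c\<in>UNIV. Gab q $ b $ c * K c i q) = - Gai b i q" if q: "q \<in> W" for q b i
  proof -
    have "(\<Sum>c\<in>UNIV. Gab q $ b $ c * K c i q)
        = - (\<Sum>c\<in>UNIV. \<Sum>a\<in>UNIV. matrix_inv (Gab q) $ a $ c * Gab q $ c $ b * Gai a i q)"
      by (simp add: K sum_distrib_left sum_negf G_sym[OF q, of b] mult_ac)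
    also have "\<dots> = - (\<Sum>a\<in>UNIV. (matrix_inv (Gab q) ** Gab q) $ a $ b * Gai a i q)"
      by (subst sum.swap) (simp add: matrix_matrix_mult_def sum_distrib_right)
    also have "\<dots> = - (\<Sum>a\<in>UNIV. if a = b then Gai a i q else 0)"
      unfolding matrix_inv_inverse(2)[OF G_invertible[OF q]]
      by (intro arg_cong[where f = uminus] sum.cong refl) (simp add: mat_def)
    finally show ?thesis by simp
  qed
  have orth: "g q (X b q) (Xv i q) = 0" if q: "q \<in> W" for b i q
  proof -
    have qp: "q \<in> pts Q" using q Wp by blast
    have "g q (X b q) (Xv i q) = g q (V i q) (X b q) + (\<Sum>c\<in>UNIV. K c i q * g q (X c q) (X b q))"
      using symmetric_tensor_commute[OF gs qp Xt[OF q] Xvt[OF q]] tensor_Xv[OF gs q Xt[OF q]] by simp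
    also have "\<dots> = Gai b i q + (\<Sum>c\<in>UNIV. Gab q $ b $ c * K c i q)"
      using symmetric_tensor_commute[OF gs qp Vt[OF q] Xt[OF q]]
        symmetric_tensor_commute[OF gs qp Xt[OF q] Xt[OF q]]
      by (simp add: Gai Gab mult.commute)
    finally show ?thesis by (simp add: K_G[OF q])
  qed

  \<comment> \<open>Brackets of the frame\<close>
  have bracket: "lie_bracket Q (Xv i) (X a) q h
      = - (\<Sum>b\<in>UNIV. K b i q * lie_bracket Q (X a) (X b) q h) - (\<Sum>b\<in>UNIV. X a q (K b i) * X b q h)"
    if q: "q \<in> W" for i a q h
  proof (cases "smooth_near Q q h")
    case True
    have Kn: "smooth_near Q q (K b i)" for b by (rule smooth_nearI[OF W q K_smooth])
    have Yn: "smooth_near Q q (\<lambda>r. Y r h)" if "vector_field Q W Y" for Y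
      by (rule vector_field_smooth_near[OF W that q True])
    have KX: "smooth_near Q q (\<lambda>r. K b i r * X b r h)" for b
      by (rule smooth_near_mult[OF QC Kn Yn[OF Xvf]])
    have "X a q (\<lambda>r. Xv i r h) = X a q (\<lambda>r. V i r h) + X a q (\<lambda>r. \<Sum>b\<in>UNIV. K b i r * X b r h)"
      unfolding Xv
      by (rule tangent_add[OF QC Xt[OF q] Yn[OF Vvf] smooth_near_sum[OF QC _ KX]]) (use q Wp in auto)
    also have "X a q (\<lambda>r. \<Sum>b\<in>UNIV. K b i r * X b r h) = (\<Sum>b\<in>UNIV. X a q (\<lambda>r. K b i r * X b r h))"
      by (rule tangent_sum[OF QC Xt[OF q] KX])
    also have "\<dots> = (\<Sum>b\<in>UNIV. K b i q * X a q (\<lambda>r. X b r h) + X a q (K b i) * X b q h)"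
      by (intro sum.cong refl tangent_mult[OF QC Xt[OF q] Kn Yn[OF Xvf]])
    finally have XXv: "X a q (\<lambda>r. Xv i r h) = X a q (\<lambda>r. V i r h)
        + (\<Sum>b\<in>UNIV. K b i q * X a q (\<lambda>r. X b r h) + X a q (K b i) * X b q h)" .
    \<comment> \<open>The generator part of the bracket cancels; only the Leibniz terms of
      \<open>K\<close> and the brackets of lifts remain. The order \<open>[X a, X b]\<close> with a
      minus sign matches the indices of \<open>R\<close> in (A').\<close>
    have "V i q (\<lambda>r. X a r h) = X a q (\<lambda>r. V i r h)"
      using fun_cong[OF V_X[OF q, of i a], of h] True by (simp add: lie_bracket_def)
    then show ?thesis
      using True XXv
      by (simp add: lie_bracket_def Xv sum.distrib sum_subtractf sum_negf right_diff_distrib)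
  next
    case False
    then show ?thesis
      using tangent_not_smooth[OF Xt[OF q] False] by (simp add: lie_bracket_def)
  qed

  \<comment> \<open>The transversal coefficients of \<open>[Xv i, X a]\<close> plus \<open>K\<close>
    contracted with \<open>[X a, X b]\<close>. By \<open>bracket\<close> that combination lies in
    the distribution.\<close>
  define \<rho> where "\<rho> i a q k = R (Inr k) (Inr i) (Inl a) q
      + (\<Sum>b\<in>UNIV. K b i q * R (Inr k) (Inl a) (Inl b) q)" for i a q k
  have \<rho>: "(\<Sum>k\<in>UNIV. \<rho> i a q k * gbarai d k q) = 0" if q: "q \<in> W" for i a d q
  proof -
    have qp: "q \<in> pts Q" using q Wp by blast
    \<comment> \<open>All terms along the lifts collected on one side, including those where
      \<open>X a\<close> differentiates \<open>K\<close>.\<close>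
    define \<mu> where "\<mu> c = - R (Inl c) (Inr i) (Inl a) q
        - (\<Sum>b\<in>UNIV. K b i q * R (Inl c) (Inl a) (Inl b) q) - X a q (K c i)" for c
    have "lincomb UNIV (\<rho> i a q) (\<lambda>k. Xv k q) h = lincomb UNIV \<mu> (\<lambda>c. X c q) h" for h
    proof -
      have frame: "lie_bracket Q (E \<alpha>) (E \<beta>) q h = (\<Sum>c\<in>UNIV. R (Inl c) \<alpha> \<beta> q * X c q h)
          + (\<Sum>k\<in>UNIV. R (Inr k) \<alpha> \<beta> q * Xv k q h)" for \<alpha> \<beta>
        unfolding R[OF q] lincomb_sum_type by (simp add: E)
      have swap: "(\<Sum>b\<in>UNIV. K b i q * (\<Sum>k\<in>UNIV. r k b * y k))
          = (\<Sum>k\<in>UNIV. (\<Sum>b\<in>UNIV. K b i q * r k b) * y k)"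
        for r :: "'l::finite \<Rightarrow> 'm \<Rightarrow> real" and y
        unfolding sum_distrib_left sum_distrib_right by (subst sum.swap) (simp add: mult_ac)
      have "(\<Sum>c\<in>UNIV. R (Inl c) (Inr i) (Inl a) q * X c q h)
          + (\<Sum>k\<in>UNIV. R (Inr k) (Inr i) (Inl a) q * Xv k q h)
          = - (\<Sum>b\<in>UNIV. K b i q * ((\<Sum>c\<in>UNIV. R (Inl c) (Inl a) (Inl b) q * X c q h)
          + (\<Sum>k\<in>UNIV. R (Inr k) (Inl a) (Inl b) q * Xv k q h))) - (\<Sum>b\<in>UNIV. X a q (K b i) * X b q h)"
        using bracket[OF q, of i a h] frame[of "Inr i" "Inl a"] frame[of "Inl a" "Inl _"] by (simp add: E)
      then show ?thesis
        by (simp add: lincomb_def \<rho>_def \<mu>_def distrib_left distrib_right left_diff_distrib sum.distrib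
            sum_subtractf sum_negf swap)
    qed
    then have eq: "lincomb UNIV (\<rho> i a q) (\<lambda>k. Xv k q) = lincomb UNIV \<mu> (\<lambda>c. X c q)" by blast
    \<comment> \<open>Orthogonality of the frame is known for \<open>g\<close> only, so the vector
      has to vanish before it is paired with \<open>gbar\<close>.\<close>
    have zero: "lincomb UNIV (\<rho> i a q) (\<lambda>k. Xv k q) = (\<lambda>h. 0)"
      by (rule orthogonal_combination_eq_0[OF Qm g qp Xt[OF q] Xvt[OF q] orth[OF q] eq])
    have "(\<Sum>k\<in>UNIV. \<rho> i a q k * gbarai d k q) = gbar q (lincomb UNIV (\<rho> i a q) (\<lambda>k. Xv k q)) (X d q)"
      using symmetric_tensor_lincomb[where Y = "\<lambda>k. Xv k q", OF Qm gbs qp Xvt[OF q] Xt[OF q]]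
        symmetric_tensor_commute[OF gbs qp Xt[OF q] Xvt[OF q]] by (simp add: gbarai)
    also have "\<dots> = 0"
      unfolding zero using symmetric_tensor_linear[where a = 0 and b = 0, OF gbs qp Xt[OF q] Xt[OF q] Xt[OF q, of d]] by simp
    finally show ?thesis .
  qed

  \<comment> \<open>The multiplier as derivative of the momentum\<close>
  have multiplier: "lam i q v = (\<Sum>a\<in>UNIV. \<Sum>b\<in>UNIV. X a q (Gai b i) * v $ a * v $ b)
      - (\<Sum>d\<in>UNIV. Gai d i q * (\<Sum>a\<in>UNIV. \<Sum>b\<in>UNIV. \<Gamma> (Inl d) a b q * v $ a * v $ b))"
    if q: "q \<in> W" for i q v
  proof -
    have qp: "q \<in> pts Q" using q Wp by blast
    have near: "vector_field_near Q q (X a)" "vector_field_near Q q (V i)" for a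
      using vector_field_near[OF W Xvf q] vector_field_near[OF W Vvf q] .
    have nt: "nabla q w (X a) \<in> tangent_space Q q" "nabla q w (V i) \<in> tangent_space Q q"
      if "w \<in> tangent_space Q q" for w a
      using levi_civita_tangent[OF levi_civita qp that] near by auto
    define S where "S a b = g q (X b q) (nabla q (X a q) (V i))" for a b
    \<comment> \<open>Vanishing torsion and bracket allow \<open>V i\<close> and \<open>X a\<close>
      to be exchanged in the covariant derivative; metric compatibility then turns the sum into the
      derivative of \<open>g(X a, X b)\<close> along \<open>V i\<close>, which is zero.\<close>
    have killing: "S a b + S b a = 0" for a b
    proof -
      have "lie_bracket Q (X a) (V i) q h = 0" for a h
        using fun_cong[OF V_X[OF q, of i a], of h] by (auto simp: lie_bracket_def split: if_splits)
      then have "nabla q (X a q) (V i) = nabla q (V i q) (X a)" for a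
        using levi_civita_torsion[OF levi_civita qp near(1,2)] by (intro ext) simp
      moreover have "0 = g q (nabla q (V i q) (X a)) (X b q) + g q (X a q) (nabla q (V i q) (X b))"
        using levi_civita_metric[OF levi_civita qp Vt[OF q] near(1) near(1)] V_G[OF q] by simp
      ultimately show ?thesis
        using symmetric_tensor_commute[OF gs qp nt(1)[OF Vt[OF q]] Xt[OF q]] by (simp add: S_def)
    qed
    \<comment> \<open>Metric compatibility splits the derivative of \<open>Gai b i\<close> along
      \<open>X a\<close> into \<open>S a b\<close> and the inner product of \<open>V i\<close> with
      the covariant derivative of \<open>X b\<close>; the latter is expanded in the frame.\<close>
    have normal: "(\<Sum>k\<in>UNIV. gij k i q * \<Gamma> (Inr k) a b q)
        = X a q (Gai b i) - S a b - (\<Sum>d\<in>UNIV. Gai d i q * \<Gamma> (Inl d) a b q)" for a b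
    proof -
      have Et: "E \<gamma> q \<in> tangent_space Q q" for \<gamma>
        using Xt[OF q] Xvt[OF q] by (cases \<gamma>) (simp_all add: E)
      \<comment> \<open>\<open>V i\<close> and \<open>Xv i\<close> differ by a vector of the
        distribution, to which \<open>Xv k\<close> is orthogonal.\<close>
      have gV: "g q (Xv k q) (V i q) = gij k i q" for k
      proof -
        have "gij k i q = g q (Xv i q) (Xv k q)"
          unfolding gij by (rule symmetric_tensor_commute[OF gs qp Xvt[OF q] Xvt[OF q]])
        also have "\<dots> = g q (V i q) (Xv k q)"
          unfolding tensor_Xv[OF gs q Xvt[OF q]] by (simp add: orth[OF q])
        also have "\<dots> = g q (Xv k q) (V i q)"
          by (rule symmetric_tensor_commute[OF gs qp Vt[OF q] Xvt[OF q]])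
        finally show ?thesis by simp
      qed
      have "g q (nabla q (X a q) (X b)) (V i q) = (\<Sum>\<gamma>\<in>UNIV. \<Gamma> \<gamma> a b q * g q (E \<gamma> q) (V i q))"
        unfolding \<Gamma>[OF q] by (rule symmetric_tensor_lincomb[OF Qm gs qp Et Vt[OF q]])
      also have "\<dots> = (\<Sum>d\<in>UNIV. \<Gamma> (Inl d) a b q * g q (X d q) (V i q))
          + (\<Sum>k\<in>UNIV. \<Gamma> (Inr k) a b q * g q (Xv k q) (V i q))"
        unfolding UNIV_Plus_UNIV[symmetric] by (subst sum.Plus) (simp_all add: E)
      also have "\<dots> = (\<Sum>d\<in>UNIV. Gai d i q * \<Gamma> (Inl d) a b q) + (\<Sum>k\<in>UNIV. gij k i q * \<Gamma> (Inr k) a b q)"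
        by (simp add: gV Gai mult.commute)
      finally show ?thesis
        using levi_civita_metric[OF levi_civita qp Xt[OF q] near, of a b] by (simp add: S_def Gai[abs_def])
    qed
    have "lam i q v = (\<Sum>a\<in>UNIV. \<Sum>b\<in>UNIV. (\<Sum>k\<in>UNIV. gij k i q * \<Gamma> (Inr k) a b q) * v $ a * v $ b)"
      unfolding lam sum_distrib_right
      by (subst sum.swap, rule sum.cong[OF refl]) (rule sum.swap)
    also have "\<dots> = (\<Sum>a\<in>UNIV. \<Sum>b\<in>UNIV. X a q (Gai b i) * v $ a * v $ b)
        - (\<Sum>a\<in>UNIV. \<Sum>b\<in>UNIV. S a b * v $ a * v $ b)
        - (\<Sum>a\<in>UNIV. \<Sum>b\<in>UNIV. \<Sum>d\<in>UNIV. Gai d i q * \<Gamma> (Inl d) a b q * v $ a * v $ b)"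
      unfolding normal by (simp add: left_diff_distrib sum_subtractf sum_distrib_right)
    also have "(\<Sum>a\<in>UNIV. \<Sum>b\<in>UNIV. S a b * v $ a * v $ b) = 0"
      by (rule sum_antisymmetric_eq_0[OF killing])
    also have "(\<Sum>a\<in>UNIV. \<Sum>b\<in>UNIV. \<Sum>d\<in>UNIV. Gai d i q * \<Gamma> (Inl d) a b q * v $ a * v $ b)
        = (\<Sum>a\<in>UNIV. \<Sum>d\<in>UNIV. \<Sum>b\<in>UNIV. Gai d i q * \<Gamma> (Inl d) a b q * v $ a * v $ b)"
      by (rule sum.cong[OF refl]) (rule sum.swap)
    also have "\<dots> = (\<Sum>d\<in>UNIV. \<Sum>a\<in>UNIV. \<Sum>b\<in>UNIV. Gai d i q * \<Gamma> (Inl d) a b q * v $ a * v $ b)"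
      by (rule sum.swap)
    finally show ?thesis by (simp add: sum_distrib_left mult.assoc)
  qed

  \<comment> \<open>Pointwise comparison of the two conditions\<close>
  have C_derivative: "\<Gamma>nh (C i) q v = \<Gamma>nh (\<theta> i) q v + lam i q v" if q: "q \<in> W" for i q v
  proof -
    have "smooth_fun Q W (gbarai a i)" "smooth_fun Q W (Gai a i)" for a
      using symmetric_tensor_smooth[OF gbs W Xvf Xvvf, of a i] symmetric_tensor_smooth[OF gs W Xvf Vvf, of a i]
      by (simp_all add: gbarai[abs_def] Gai[abs_def])
    then have n: "smooth_near Q q (gbarai a i)" "smooth_near Q q (Gai a i)" for a
      using smooth_nearI[OF W q] by auto
    have "C i = (\<lambda>r w. \<Sum>a\<in>UNIV. (gbarai a i r + Gai a i r) * w $ a)"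
      "\<theta> i = (\<lambda>r w. \<Sum>a\<in>UNIV. gbarai a i r * w $ a)"
      by (intro ext C \<theta>)+
    then show ?thesis
      unfolding \<Gamma>nh multiplier[OF q]
      using nonholonomic_field_add_linear[where X = X and \<theta> = "\<lambda>a. gbarai a i" and \<eta> = "\<lambda>a. Gai a i"
          and \<Gamma> = "\<lambda>d. \<Gamma> (Inl d)" and v = v, OF QC Xt[OF q] n]
      by simp
  qed

  have "\<Gamma>nh (\<theta> i) q v + lam i q v
        + (\<Sum>k\<in>UNIV. \<Sum>a\<in>UNIV. \<theta> k q v *
             (R (Inr k) (Inr i) (Inl a) q + (if k = i then 1 else 0) * X a q F) * v $ a)
        - (\<Sum>a\<in>UNIV. \<Sum>b\<in>UNIV. Gab q $ a $ b * Xv i q F * v $ a * v $ b)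
      = \<Gamma>nh (C i) q v + \<Gamma>nh (\<lambda>r w. F r) q v * C i q v" if q: "q \<in> W" for i q v
  proof -
    \<comment> \<open>\<open>P\<close> is the nonholonomic derivative of \<open>F\<close>,
      \<open>L\<close> the momentum of \<open>v\<close> along \<open>V i\<close>, \<open>G2\<close>
      twice the kinetic energy, and \<open>H\<close> the curvature term of (B').\<close>
    define P where "P = (\<Sum>a\<in>UNIV. X a q F * v $ a)"
    define L where "L = (\<Sum>b\<in>UNIV. Gai b i q * v $ b)"
    define G2 where "G2 = (\<Sum>a\<in>UNIV. \<Sum>b\<in>UNIV. Gab q $ a $ b * v $ a * v $ b)"
    define H where "H = (\<Sum>k\<in>UNIV. \<Sum>a\<in>UNIV. \<theta> k q v * R (Inr k) (Inr i) (Inl a) q * v $ a)"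
    have XvF: "Xv i q F = (\<Sum>c\<in>UNIV. K c i q * X c q F)"
      by (simp add: Xv V_F[OF q])
    have Q2: "(\<Sum>a\<in>UNIV. \<Sum>b\<in>UNIV. Gab q $ b $ a * v $ a * v $ b) = G2"
      unfolding G2_def by (simp add: G_sym[OF q])
    have A: "G2 * X c q F - (\<Sum>b\<in>UNIV. Gab q $ b $ c * v $ b) * P
        + (\<Sum>k\<in>UNIV. \<Sum>a\<in>UNIV. \<theta> k q v * R (Inr k) (Inl a) (Inl c) q * v $ a) = 0" for c
    proof -
      have "(\<Sum>a\<in>UNIV. \<Sum>b\<in>UNIV. (Gab q $ b $ a * X c q F - Gab q $ b $ c * X a q F) * v $ a * v $ b)
          = (\<Sum>a\<in>UNIV. \<Sum>b\<in>UNIV. Gab q $ b $ a * v $ a * v $ b) * X c q F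
            - (\<Sum>a\<in>UNIV. \<Sum>b\<in>UNIV. (Gab q $ b $ c * v $ b) * (X a q F * v $ a))"
        unfolding sum_distrib_right sum_subtractf[symmetric]
        by (intro sum.cong refl) (simp add: algebra_simps)
      also have "(\<Sum>a\<in>UNIV. \<Sum>b\<in>UNIV. (Gab q $ b $ c * v $ b) * (X a q F * v $ a))
          = (\<Sum>b\<in>UNIV. Gab q $ b $ c * v $ b) * P"
        unfolding P_def sum_product by (rule sum.swap)
      finally show ?thesis
        using A'[THEN bspec, OF q, THEN spec, of v, THEN spec, of c] by (simp only: sum_delta_difference Q2)
    qed
    have "0 = (\<Sum>c\<in>UNIV. K c i q * (G2 * X c q F - (\<Sum>b\<in>UNIV. Gab q $ b $ c * v $ b) * P
        + (\<Sum>k\<in>UNIV. \<Sum>a\<in>UNIV. \<theta> k q v * R (Inr k) (Inl a) (Inl c) q * v $ a)))"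
      by (simp only: A mult_zero_right sum.neutral_const)
    also have "\<dots> = G2 * Xv i q F - (\<Sum>c\<in>UNIV. \<Sum>b\<in>UNIV. (Gab q $ b $ c * K c i q) * v $ b) * P
        + (\<Sum>c\<in>UNIV. \<Sum>k\<in>UNIV. \<Sum>a\<in>UNIV. \<theta> k q v * (K c i q * R (Inr k) (Inl a) (Inl c) q) * v $ a)"
      by (simp add: XvF distrib_left right_diff_distrib sum.distrib sum_subtractf sum_distrib_left
          sum_distrib_right mult_ac)
    \<comment> \<open>The choice of \<open>K\<close> makes the momentum appear here.\<close>
    also have "(\<Sum>c\<in>UNIV. \<Sum>b\<in>UNIV. (Gab q $ b $ c * K c i q) * v $ b) = - L"
      unfolding L_def
      by (subst sum.swap) (simp add: sum_distrib_right[symmetric] K_G[OF q] sum_negf)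
    also have "(\<Sum>c\<in>UNIV. \<Sum>k\<in>UNIV. \<Sum>a\<in>UNIV. \<theta> k q v * (K c i q * R (Inr k) (Inl a) (Inl c) q) * v $ a) = - H"
    proof -
      \<comment> \<open>\<open>\<theta>\<close> is linear in \<open>gbarai\<close>, so the identity
        for \<open>\<rho>\<close> applies to each component of \<open>v\<close>. It converts the
        curvature of two lifts in (A') into that of \<open>Xv i\<close> and a lift in (B').\<close>
      have \<theta>\<rho>: "(\<Sum>k\<in>UNIV. \<theta> k q v * \<rho> i a q k) = 0" for a
      proof -
        have "(\<Sum>k\<in>UNIV. \<theta> k q v * \<rho> i a q k)
            = (\<Sum>d\<in>UNIV. (\<Sum>k\<in>UNIV. \<rho> i a q k * gbarai d k q) * v $ d)"
          unfolding \<theta> sum_distrib_right by (subst sum.swap) (simp add: mult_ac)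
        then show ?thesis by (simp add: \<rho>[OF q])
      qed
      have "(\<Sum>c\<in>UNIV. \<Sum>k\<in>UNIV. \<Sum>a\<in>UNIV. \<theta> k q v * (K c i q * R (Inr k) (Inl a) (Inl c) q) * v $ a)
          = (\<Sum>k\<in>UNIV. \<Sum>c\<in>UNIV. \<Sum>a\<in>UNIV. \<theta> k q v * (K c i q * R (Inr k) (Inl a) (Inl c) q) * v $ a)"
        by (rule sum.swap)
      also have "\<dots> = (\<Sum>k\<in>UNIV. \<Sum>a\<in>UNIV. \<Sum>c\<in>UNIV. \<theta> k q v * (K c i q * R (Inr k) (Inl a) (Inl c) q) * v $ a)"
        by (rule sum.cong[OF refl]) (rule sum.swap)
      also have "\<dots> + H = (\<Sum>k\<in>UNIV. \<Sum>a\<in>UNIV. \<theta> k q v * \<rho> i a q k * v $ a)"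
        by (simp add: H_def \<rho>_def distrib_left distrib_right sum.distrib sum_distrib_left sum_distrib_right)
      also have "\<dots> = (\<Sum>a\<in>UNIV. (\<Sum>k\<in>UNIV. \<theta> k q v * \<rho> i a q k) * v $ a)"
        unfolding sum_distrib_right by (rule sum.swap)
      also have "\<dots> = 0" by (simp add: \<theta>\<rho>)
      finally show ?thesis by simp
    qed
    \<comment> \<open>The contracted (A'). The Kronecker term of (B') contributes
      \<open>\<theta> i q v * P\<close>; together with \<open>L * P\<close> this is \<open>P\<close>
      times \<open>C i q v\<close>.\<close>
    finally have key: "H - G2 * Xv i q F = L * P" by simp
    have "(\<Sum>a\<in>UNIV. (if k = i then 1 else 0) * (\<theta> k q v * (X a q F * v $ a)))
        = (if k = i then \<theta> k q v * P else 0)" for k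
      by (simp add: P_def sum_distrib_left)
    then have "(\<Sum>k\<in>UNIV. \<Sum>a\<in>UNIV. \<theta> k q v *
        (R (Inr k) (Inr i) (Inl a) q + (if k = i then 1 else 0) * X a q F) * v $ a)
        = H + (\<Sum>k\<in>UNIV. if k = i then \<theta> k q v * P else 0)"
      unfolding H_def sum.distrib[symmetric]
      by (intro sum.cong refl) (simp add: distrib_left distrib_right sum.distrib mult_ac)
    moreover have "(\<Sum>a\<in>UNIV. \<Sum>b\<in>UNIV. Gab q $ a $ b * Xv i q F * v $ a * v $ b) = G2 * Xv i q F"
      unfolding G2_def sum_distrib_right by (simp add: mult_ac)
    moreover have "\<Gamma>nh (\<lambda>r w. F r) q v = P"
      by (simp add: \<Gamma>nh nonholonomic_field_def P_def mult.commute)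
    moreover have "C i q v = \<theta> i q v + L"
      by (simp add: C \<theta> L_def distrib_right sum.distrib)
    ultimately show ?thesis
      using key C_derivative[OF q, of i v] by (simp add: algebra_simps)
  qed
  then show ?thesis by simp
qed

end
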